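(* Let $\lambda\in\mathbf{k}$. (i) Let $A$ be a $\mathbf{k}$-algebra and let $A=\mathbf{k}\langle X\rangle/I_A$ be a presentation of $A$ with generating set $X$ and ideal $I_A$. Let $\mathfrak I_A=\mathrm{DI}(I_A)$ be the differential ideal of $\mathbf{k}\langle\Delta(X)\rangle$ generated by (the image under $x\mapsto x^{(0)}$ of) $I_A$. Then $\mathcal{D}_\lambda(A)=\mathbf{k}\langle\Delta(X)\rangle/\mathfrak I_A$ is a presentation of the free differential algebra of weight $\lambda$ on $A$. (ii) Similarly, let $A=\mathbf{k}[X]/I_A$ be a commutative algebra and let $\mathfrak I_A=\mathrm{DI}(I_A)$ be the differential ideal of $\mathbf{k}[\Delta(X)]$ generated by (the image under $x\mapsto x^{(0)}$ of) $I_A$. Then the free commutative differential algebra $\mathcal{CD}_\lambda(A)$ of weight $\lambda$ on $A$ has the presentation $\mathcal{CD}_\lambda(A)=\mathbf{k}[\Delta(X)]/\mathfrak I_A$.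
   Context: $\mathbf{k}$ is a field of characteristic $0$; algebras are associative unital $\mathbf{k}$-algebras. A differential algebra of weight $\lambda$ is an algebra $R$ with a linear map $d:R\to R$ such that $d(xy)=d(x)y+x\,d(y)+\lambda d(x)d(y)$ for all $x,y\in R$ and $d(1)=0$; homomorphisms are algebra homomorphisms commuting with the operators. A differential ideal is an ideal $I$ with $d(I)\subseteq I$ (so the quotient inherits a differential operator); $\mathrm{DI}(U)$ is the smallest differential ideal containing $U$. The free differential algebra of weight $\lambda$ on an algebra $A$ is a differential algebra $(\mathcal{D}_\lambda(A),d_A)$ of weight $\lambda$ with an algebra homomorphism $i_A:A\to\mathcal{D}_\lambda(A)$ such that every algebra homomorphism $\varphi:A\to R$ to a differential algebra $(R,d)$ of weight $\lambda$ factors as $\varphi=\bar\varphi\circ i_A$ for a unique differential algebra homomorphism $\bar\varphi:\mathcal{D}_\lambda(A)\to R$. For commutative $A$, the free commutative differential algebra $(\mathcal{CD}_\lambda(A),d_A)$ of weight $\lambda$ on $A$ is defined by the same universal property within commutative differential algebras of weight $\lambda$. $\Delta(X)=\{x^{(n)}\mid x\in X,\ n\ge0\}$ (distinct symbols). $\mathbf{k}\langle\Delta(X)\rangle$ (resp. $\mathbf{k}[\Delta(X)]$) is the noncommutative (resp. commutative) polynomial algebra on $\Delta(X)$, with the unique weight-$\lambda$ differential operator $d_X$ such that $d_X(x^{(n)})=x^{(n+1)}$; it is the free (resp. free commutative) differential algebra of weight $\lambda$ on the set $X$. $\mathbf{k}\langle X\rangle$ (resp. $\mathbf{k}[X]$)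 is embedded in it as a subalgebra via $x\mapsto x^{(0)}$. In (i) and (ii), the structure map $i_A$ is the one induced by this embedding. *)

theory Defs
  imports "HOL-Algebra.QuotRing" "HOL-Algebra.Module" "HOL-Library.Multiset"
begin

section \<open>Algebras over a field of characteristic zero\<close>

locale field_char_zero = field K for K (structure) +
  assumes char_zero: "0 < n \<Longrightarrow> add_pow K (n::nat) \<one> \<noteq> \<zero>"

text \<open>
  The library locale \<^locale>\<open>algebra\<close> describes commutative algebras only. The zero
  algebra is allowed here, as \<^locale>\<open>ring\<close> does not require that one differs from zero.
\<close>

locale assoc_algebra = module K A + ring A for K and A (structure) +
  assumes smult_mult_left:
      "\<lbrakk>a \<in> carrier K; x \<in> carrier A; y \<in> carrier A\<rbrakk> \<Longrightarrow> (a \<odot> x) \<otimes> y = a \<odot> (x \<otimes> y)"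
    and smult_mult_right:
      "\<lbrakk>a \<in> carrier K; x \<in> carrier A; y \<in> carrier A\<rbrakk> \<Longrightarrow> x \<otimes> (a \<odot> y) = a \<odot> (x \<otimes> y)"

definition alg_hom ::
  "('k, 'm) ring_scheme \<Rightarrow> ('k, 'a, 'n) module_scheme \<Rightarrow> ('k, 'b, 'p) module_scheme \<Rightarrow> ('a \<Rightarrow> 'b) set"
  where "alg_hom K A B =
    {f \<in> ring_hom A B. \<forall>a\<in>carrier K. \<forall>x\<in>carrier A. f (a \<odot>\<^bsub>A\<^esub> x) = a \<odot>\<^bsub>B\<^esub> f x}"

definition alg_iso ::
  "('k, 'm) ring_scheme \<Rightarrow> ('k, 'a, 'n) module_scheme \<Rightarrow> ('k, 'b, 'p) module_scheme \<Rightarrow> ('a \<Rightarrow> 'b) set"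
  where "alg_iso K A B = {f \<in> alg_hom K A B. bij_betw f (carrier A) (carrier B)}"

text \<open>
  An ideal of a unital algebra is automatically closed under scalars, so the quotient by a
  (two-sided) ring ideal is again an algebra.
\<close>

definition alg_quot :: "('k, 'a, 'n) module_scheme \<Rightarrow> 'a set \<Rightarrow> ('k, 'a set) module"
  where "alg_quot A I =
    ring.extend (A Quot I) (module.fields (\<lambda>a C. \<Union>x\<in>C. I +>\<^bsub>A\<^esub> (a \<odot>\<^bsub>A\<^esub> x)))"


section \<open>Differential algebras of weight \<open>\<lambda>\<close>\<close>

locale differential_algebra = assoc_algebra K R for K and l and R (structure) and d +
  assumes weight_closed: "l \<in> carrier K"
    and d_closed: "x \<in> carrier R \<Longrightarrow> d x \<in> carrier R"
    and d_add: "\<lbrakk>x \<in> carrier R; y \<in> carrier R\<rbrakk> \<Longrightarrow> d (x \<oplus> y) = d x \<oplus> d y"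
    and d_smult: "\<lbrakk>a \<in> carrier K; x \<in> carrier R\<rbrakk> \<Longrightarrow> d (a \<odot> x) = a \<odot> d x"
    and d_mult: "\<lbrakk>x \<in> carrier R; y \<in> carrier R\<rbrakk> \<Longrightarrow>
      d (x \<otimes> y) = d x \<otimes> y \<oplus> x \<otimes> d y \<oplus> l \<odot> (d x \<otimes> d y)"
    and d_one: "d \<one> = \<zero>"

definition diff_alg_hom ::
  "('k, 'm) ring_scheme \<Rightarrow> ('k, 'a, 'n) module_scheme \<Rightarrow> ('a \<Rightarrow> 'a) \<Rightarrow>
    ('k, 'b, 'p) module_scheme \<Rightarrow> ('b \<Rightarrow> 'b) \<Rightarrow> ('a \<Rightarrow> 'b) set"
  where "diff_alg_hom K R d S e = {f \<in> alg_hom K R S. \<forall>x\<in>carrier R. f (d x) = e (f x)}"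

definition differential_ideal :: "'a set \<Rightarrow> ('a, 'n) ring_scheme \<Rightarrow> ('a \<Rightarrow> 'a) \<Rightarrow> bool"
  where "differential_ideal I R d \<longleftrightarrow> ideal I R \<and> d ` I \<subseteq> I"

definition diff_genideal :: "('a, 'n) ring_scheme \<Rightarrow> ('a \<Rightarrow> 'a) \<Rightarrow> 'a set \<Rightarrow> 'a set"
  where "diff_genideal R d U = \<Inter>{I. differential_ideal I R d \<and> U \<subseteq> I}"

definition diff_quot :: "('a, 'n) ring_scheme \<Rightarrow> ('a \<Rightarrow> 'a) \<Rightarrow> 'a set \<Rightarrow> 'a set \<Rightarrow> 'a set"
  where "diff_quot R d I = (\<lambda>C. \<Union>x\<in>C. I +>\<^bsub>R\<^esub> d x)"

text \<open>
  A universal property cannot quantify over types inside a definition, so the type of the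
  carriers of the test algebras \<open>R\<close> is a parameter: it is left as a type variable
  wherever the notion is used. Maps are total functions in HOL, so uniqueness of the
  factorization is stated for functions that are normalized to \<open>undefined\<close> outside the carrier.
\<close>

definition free_differential_algebra ::
  "'r itself \<Rightarrow> ('k, 'm) ring_scheme \<Rightarrow> 'k \<Rightarrow> ('k, 'a) module \<Rightarrow>
    ('k, 'b) module \<Rightarrow> ('b \<Rightarrow> 'b) \<Rightarrow> ('a \<Rightarrow> 'b) \<Rightarrow> bool"
  where "free_differential_algebra (_ :: 'r itself) K l A D d i \<longleftrightarrow>
    differential_algebra K l D d \<and> i \<in> alg_hom K A D \<and>
    (\<forall>(R :: ('k, 'r) module) e \<phi>.
      differential_algebra K l R e \<and> \<phi> \<in> alg_hom K A R \<longrightarrow>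
      (\<exists>!\<psi>. \<psi> \<in> extensional (carrier D) \<and> \<psi> \<in> diff_alg_hom K D d R e \<and>
        (\<forall>a\<in>carrier A. \<phi> a = \<psi> (i a))))"

definition free_comm_differential_algebra ::
  "'r itself \<Rightarrow> ('k, 'm) ring_scheme \<Rightarrow> 'k \<Rightarrow> ('k, 'a) module \<Rightarrow>
    ('k, 'b) module \<Rightarrow> ('b \<Rightarrow> 'b) \<Rightarrow> ('a \<Rightarrow> 'b) \<Rightarrow> bool"
  where "free_comm_differential_algebra (_ :: 'r itself) K l A D d i \<longleftrightarrow>
    differential_algebra K l D d \<and> cring D \<and> i \<in> alg_hom K A D \<and>
    (\<forall>(R :: ('k, 'r) module) e \<phi>.
      differential_algebra K l R e \<and> cring R \<and> \<phi> \<in> alg_hom K A R \<longrightarrow>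
      (\<exists>!\<psi>. \<psi> \<in> extensional (carrier D) \<and> \<psi> \<in> diff_alg_hom K D d R e \<and>
        (\<forall>a\<in>carrier A. \<phi> a = \<psi> (i a))))"


section \<open>Polynomial algebras\<close>

text \<open>
  Both kinds of polynomial algebra are monoid algebras: a polynomial is the finitely supported
  function that sends a monomial (an element of the monoid) to its coefficient.
\<close>

definition monoid_algebra :: "('k, 'm) ring_scheme \<Rightarrow> ('w, 'n) monoid_scheme \<Rightarrow> ('k, 'w \<Rightarrow> 'k) module"
  where "monoid_algebra K M =
    \<lparr>carrier = {f. (\<forall>w. f w \<in> carrier K) \<and> (\<forall>w. w \<notin> carrier M \<longrightarrow> f w = \<zero>\<^bsub>K\<^esub>) \<and>
                   finite {w. f w \<noteq> \<zero>\<^bsub>K\<^esub>}},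
     monoid.mult = (\<lambda>f g w. finsum K (\<lambda>(u, v). f u \<otimes>\<^bsub>K\<^esub> g v)
               {(u, v). f u \<noteq> \<zero>\<^bsub>K\<^esub> \<and> g v \<noteq> \<zero>\<^bsub>K\<^esub> \<and> u \<otimes>\<^bsub>M\<^esub> v = w}),
     one = (\<lambda>w. if w = \<one>\<^bsub>M\<^esub> then \<one>\<^bsub>K\<^esub> else \<zero>\<^bsub>K\<^esub>),
     zero = (\<lambda>w. \<zero>\<^bsub>K\<^esub>),
     add = (\<lambda>f g w. f w \<oplus>\<^bsub>K\<^esub> g w),
     smult = (\<lambda>a f w. a \<otimes>\<^bsub>K\<^esub> f w)\<rparr>"

definition monomial :: "('k, 'm) ring_scheme \<Rightarrow> 'w \<Rightarrow> 'w \<Rightarrow> 'k"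
  where "monomial K w = (\<lambda>u. if u = w then \<one>\<^bsub>K\<^esub> else \<zero>\<^bsub>K\<^esub>)"

text \<open>The linear extension of a map \<open>h\<close> on monomials.\<close>

definition monoid_algebra_map :: "('k, 'm) ring_scheme \<Rightarrow> ('v \<Rightarrow> 'w) \<Rightarrow> ('v \<Rightarrow> 'k) \<Rightarrow> 'w \<Rightarrow> 'k"
  where "monoid_algebra_map K h f = (\<lambda>w. \<Oplus>\<^bsub>K\<^esub>u\<in>{u. f u \<noteq> \<zero>\<^bsub>K\<^esub> \<and> h u = w}. f u)"

definition free_monoid :: "'x set \<Rightarrow> 'x list monoid"
  where "free_monoid X = \<lparr>carrier = lists X, monoid.mult = (@), one = []\<rparr>"

definition free_comm_monoid :: "'x set \<Rightarrow> 'x multiset monoid"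
  where "free_comm_monoid X = \<lparr>carrier = {m. set_mset m \<subseteq> X}, monoid.mult = (+), one = {#}\<rparr>"

definition nc_poly :: "('k, 'm) ring_scheme \<Rightarrow> 'x set \<Rightarrow> ('k, 'x list \<Rightarrow> 'k) module"
  where "nc_poly K X = monoid_algebra K (free_monoid X)"

definition comm_poly :: "('k, 'm) ring_scheme \<Rightarrow> 'x set \<Rightarrow> ('k, 'x multiset \<Rightarrow> 'k) module"
  where "comm_poly K X = monoid_algebra K (free_comm_monoid X)"


section \<open>Differential polynomial algebras\<close>

text \<open>The pair \<open>(x, n)\<close> encodes the symbol written x with superscript (n).\<close>

definition Delta :: "'x set \<Rightarrow> ('x \<times> nat) set"
  where "Delta X = X \<times> UNIV"

definition nc_diff_op ::
  "('k, 'm) ring_scheme \<Rightarrow> 'k \<Rightarrow> 'x set \<Rightarrow> (('x \<times> nat) list \<Rightarrow> 'k) \<Rightarrow> (('x \<times> nat) list \<Rightarrow> 'k)"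
  where "nc_diff_op K l X = (THE d. d \<in> extensional (carrier (nc_poly K (Delta X))) \<and>
    differential_algebra K l (nc_poly K (Delta X)) d \<and>
    (\<forall>x\<in>X. \<forall>n. d (monomial K [(x, n)]) = monomial K [(x, Suc n)]))"

definition comm_diff_op ::
  "('k, 'm) ring_scheme \<Rightarrow> 'k \<Rightarrow> 'x set \<Rightarrow> (('x \<times> nat) multiset \<Rightarrow> 'k) \<Rightarrow> (('x \<times> nat) multiset \<Rightarrow> 'k)"
  where "comm_diff_op K l X = (THE d. d \<in> extensional (carrier (comm_poly K (Delta X))) \<and>
    differential_algebra K l (comm_poly K (Delta X)) d \<and>
    (\<forall>x\<in>X. \<forall>n. d (monomial K {#(x, n)#}) = monomial K {#(x, Suc n)#}))"

definition nc_embed :: "('k, 'm) ring_scheme \<Rightarrow> ('x list \<Rightarrow> 'k) \<Rightarrow> (('x \<times> nat) list \<Rightarrow> 'k)"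
  where "nc_embed K = monoid_algebra_map K (map (\<lambda>x. (x, 0)))"

definition comm_embed :: "('k, 'm) ring_scheme \<Rightarrow> ('x multiset \<Rightarrow> 'k) \<Rightarrow> (('x \<times> nat) multiset \<Rightarrow> 'k)"
  where "comm_embed K = monoid_algebra_map K (image_mset (\<lambda>x. (x, 0)))"

definition nc_diff_ideal ::
  "('k, 'm) ring_scheme \<Rightarrow> 'k \<Rightarrow> 'x set \<Rightarrow> ('x list \<Rightarrow> 'k) set \<Rightarrow> (('x \<times> nat) list \<Rightarrow> 'k) set"
  where "nc_diff_ideal K l X I =
    diff_genideal (nc_poly K (Delta X)) (nc_diff_op K l X) (nc_embed K ` I)"

definition comm_diff_ideal ::
  "('k, 'm) ring_scheme \<Rightarrow> 'k \<Rightarrow> 'x set \<Rightarrow> ('x multiset \<Rightarrow> 'k) set \<Rightarrow> (('x \<times> nat) multiset \<Rightarrow> 'k) set"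
  where "comm_diff_ideal K l X I =
    diff_genideal (comm_poly K (Delta X)) (comm_diff_op K l X) (comm_embed K ` I)"

text \<open>
  Let \<open>\<theta>\<close> be an isomorphism from the quotient of \<open>P\<close> by \<open>I\<close> onto \<open>A\<close>, and let
  \<open>\<iota>\<close> map \<open>P\<close> to \<open>Q\<close> and \<open>I\<close> into \<open>J\<close>. The induced map from \<open>A\<close> to the quotient of \<open>Q\<close>
  by \<open>J\<close> sends \<open>\<theta> (I + f)\<close> to \<open>J + \<iota> f\<close>: on the coset that corresponds to an element of \<open>A\<close>
  the function \<open>f \<mapsto> J + \<iota> f\<close> is constant.
\<close>

definition induced_map ::
  "('p, 'm) ring_scheme \<Rightarrow> 'p set \<Rightarrow> ('p set \<Rightarrow> 'a) \<Rightarrow> ('q, 'n) ring_scheme \<Rightarrow> 'q set \<Rightarrow>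
    ('p \<Rightarrow> 'q) \<Rightarrow> 'a \<Rightarrow> 'q set"
  where "induced_map P I \<theta> Q J \<iota> =
    (\<lambda>a. the_elem ((\<lambda>f. J +>\<^bsub>Q\<^esub> \<iota> f) ` inv_into (carrier (P Quot I)) \<theta> a))"

end

theory Submission
  imports Defs
begin

text \<open>Two obstacles shape the development. The operator on the differential polynomial algebra
  is given by a definite description, so its unique existence must be proved before the presentation
  can be treated. Freeness yields algebra homomorphisms only, and an operator obeying the weighted
  product rule is not one. Adjoining \<epsilon> with \<epsilon> * \<epsilon> = l \<epsilon> repairs
  this: the operator is the \<epsilon>-part of a homomorphism sending each generator x^(n) to x^(n)
  + x^(n+1) \<epsilon>, and such a homomorphism comes from freeness. The second obstacle is the pair
  of parallel cases. Both polynomial algebras are monoid algebras, so their structure and extension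
  properties follow from the corresponding monoids. They differ in the targets to which generators
  may be mapped freely: all algebras, or only commutative ones. The argument for the quotient
  therefore takes this extension property as a premise about one target at a time. Commutation with
  the operators can be tested on generators because both ways round the square satisfy the same
  product rule along the homomorphism.\<close>

text \<open>
  Given \<open>\<phi> : A \<rightarrow> R\<close>, the differential polynomial algebra \<open>Q\<close> on \<open>X\<close> maps to \<open>R\<close> by sending
  \<open>(x, n)\<close> to the \<open>n\<close>-th derivative of the image of \<open>x\<close>. This map commutes with the
  differential operators, and on \<open>k\<langle>X\<rangle>\<close> it agrees with \<open>\<phi>\<close> composed with the projection onto
  \<open>A\<close>; its kernel is therefore a differential ideal containing \<open>I\<close>, and it factors through the
  quotient. A factorization is determined by its values on the generators \<open>(x, 0)\<close>, as the
  other generators are their derivatives.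
\<close>

section \<open>Algebras and their homomorphisms\<close>

lemma assoc_algebraI:
  fixes K (structure) and A (structure)
  assumes "cring K"
    and "\<And>x y. \<lbrakk>x \<in> carrier A; y \<in> carrier A\<rbrakk> \<Longrightarrow> x \<oplus>\<^bsub>A\<^esub> y \<in> carrier A"
    and "\<zero>\<^bsub>A\<^esub> \<in> carrier A"
    and "\<And>x y z. \<lbrakk>x \<in> carrier A; y \<in> carrier A; z \<in> carrier A\<rbrakk> \<Longrightarrow>
      (x \<oplus>\<^bsub>A\<^esub> y) \<oplus>\<^bsub>A\<^esub> z = x \<oplus>\<^bsub>A\<^esub> (y \<oplus>\<^bsub>A\<^esub> z)"
    and "\<And>x y. \<lbrakk>x \<in> carrier A; y \<in> carrier A\<rbrakk> \<Longrightarrow> x \<oplus>\<^bsub>A\<^esub> y = y \<oplus>\<^bsub>A\<^esub> x"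
    and "\<And>x. x \<in> carrier A \<Longrightarrow> \<zero>\<^bsub>A\<^esub> \<oplus>\<^bsub>A\<^esub> x = x"
    and "\<And>x. x \<in> carrier A \<Longrightarrow> \<exists>y\<in>carrier A. y \<oplus>\<^bsub>A\<^esub> x = \<zero>\<^bsub>A\<^esub>"
    and "\<And>x y. \<lbrakk>x \<in> carrier A; y \<in> carrier A\<rbrakk> \<Longrightarrow> x \<otimes>\<^bsub>A\<^esub> y \<in> carrier A"
    and "\<one>\<^bsub>A\<^esub> \<in> carrier A"
    and "\<And>x y z. \<lbrakk>x \<in> carrier A; y \<in> carrier A; z \<in> carrier A\<rbrakk> \<Longrightarrow>
      (x \<otimes>\<^bsub>A\<^esub> y) \<otimes>\<^bsub>A\<^esub> z = x \<otimes>\<^bsub>A\<^esub> (y \<otimes>\<^bsub>A\<^esub> z)"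
    and "\<And>x. x \<in> carrier A \<Longrightarrow> \<one>\<^bsub>A\<^esub> \<otimes>\<^bsub>A\<^esub> x = x"
    and "\<And>x. x \<in> carrier A \<Longrightarrow> x \<otimes>\<^bsub>A\<^esub> \<one>\<^bsub>A\<^esub> = x"
    and "\<And>x y z. \<lbrakk>x \<in> carrier A; y \<in> carrier A; z \<in> carrier A\<rbrakk> \<Longrightarrow>
      (x \<oplus>\<^bsub>A\<^esub> y) \<otimes>\<^bsub>A\<^esub> z = x \<otimes>\<^bsub>A\<^esub> z \<oplus>\<^bsub>A\<^esub> y \<otimes>\<^bsub>A\<^esub> z"
    and "\<And>x y z. \<lbrakk>x \<in> carrier A; y \<in> carrier A; z \<in> carrier A\<rbrakk> \<Longrightarrow>
      z \<otimes>\<^bsub>A\<^esub> (x \<oplus>\<^bsub>A\<^esub> y) = z \<otimes>\<^bsub>A\<^esub> x \<oplus>\<^bsub>A\<^esub> z \<otimes>\<^bsub>A\<^esub> y"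
    and "\<And>a x. \<lbrakk>a \<in> carrier K; x \<in> carrier A\<rbrakk> \<Longrightarrow> a \<odot>\<^bsub>A\<^esub> x \<in> carrier A"
    and "\<And>a b x. \<lbrakk>a \<in> carrier K; b \<in> carrier K; x \<in> carrier A\<rbrakk> \<Longrightarrow>
      (a \<oplus> b) \<odot>\<^bsub>A\<^esub> x = a \<odot>\<^bsub>A\<^esub> x \<oplus>\<^bsub>A\<^esub> b \<odot>\<^bsub>A\<^esub> x"
    and "\<And>a x y. \<lbrakk>a \<in> carrier K; x \<in> carrier A; y \<in> carrier A\<rbrakk> \<Longrightarrow>
      a \<odot>\<^bsub>A\<^esub> (x \<oplus>\<^bsub>A\<^esub> y) = a \<odot>\<^bsub>A\<^esub> x \<oplus>\<^bsub>A\<^esub> a \<odot>\<^bsub>A\<^esub> y"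
    and "\<And>a b x. \<lbrakk>a \<in> carrier K; b \<in> carrier K; x \<in> carrier A\<rbrakk> \<Longrightarrow>
      (a \<otimes> b) \<odot>\<^bsub>A\<^esub> x = a \<odot>\<^bsub>A\<^esub> (b \<odot>\<^bsub>A\<^esub> x)"
    and "\<And>x. x \<in> carrier A \<Longrightarrow> \<one> \<odot>\<^bsub>A\<^esub> x = x"
    and "\<And>a x y. \<lbrakk>a \<in> carrier K; x \<in> carrier A; y \<in> carrier A\<rbrakk> \<Longrightarrow>
      (a \<odot>\<^bsub>A\<^esub> x) \<otimes>\<^bsub>A\<^esub> y = a \<odot>\<^bsub>A\<^esub> (x \<otimes>\<^bsub>A\<^esub> y)"
    and "\<And>a x y. \<lbrakk>a \<in> carrier K; x \<in> carrier A; y \<in> carrier A\<rbrakk> \<Longrightarrow>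
      x \<otimes>\<^bsub>A\<^esub> (a \<odot>\<^bsub>A\<^esub> y) = a \<odot>\<^bsub>A\<^esub> (x \<otimes>\<^bsub>A\<^esub> y)"
  shows "assoc_algebra K A"
proof -
  have ab: "abelian_group A"
    by (rule abelian_groupI) (use assms in auto)
  have mo: "Group.monoid A"
    by (rule Group.monoidI) (use assms in auto)
  have "ring A"
    by (rule ringI[OF ab mo]) (use assms in auto)
  moreover have "module K A"
    by (rule moduleI[OF assms(1) ab]) (use assms in auto)
  ultimately show ?thesis
    by (intro assoc_algebra.intro assoc_algebra_axioms.intro) (use assms in auto)
qed

lemma alg_homI:
  assumes "\<And>x. x \<in> carrier A \<Longrightarrow> f x \<in> carrier B"
    and "\<And>x y. \<lbrakk>x \<in> carrier A; y \<in> carrier A\<rbrakk> \<Longrightarrow> f (x \<otimes>\<^bsub>A\<^esub> y) = f x \<otimes>\<^bsub>B\<^esub> f y"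
    and "\<And>x y. \<lbrakk>x \<in> carrier A; y \<in> carrier A\<rbrakk> \<Longrightarrow> f (x \<oplus>\<^bsub>A\<^esub> y) = f x \<oplus>\<^bsub>B\<^esub> f y"
    and "f \<one>\<^bsub>A\<^esub> = \<one>\<^bsub>B\<^esub>"
    and "\<And>a x. \<lbrakk>a \<in> carrier K; x \<in> carrier A\<rbrakk> \<Longrightarrow> f (a \<odot>\<^bsub>A\<^esub> x) = a \<odot>\<^bsub>B\<^esub> f x"
  shows "f \<in> alg_hom K A B"
  using assms unfolding alg_hom_def by (auto intro!: ring_hom_memI)

lemma alg_homD:
  assumes "f \<in> alg_hom K A B"
  shows "\<And>x. x \<in> carrier A \<Longrightarrow> f x \<in> carrier B"
    and "\<And>x y. \<lbrakk>x \<in> carrier A; y \<in> carrier A\<rbrakk> \<Longrightarrow> f (x \<otimes>\<^bsub>A\<^esub> y) = f x \<otimes>\<^bsub>B\<^esub> f y"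
    and "\<And>x y. \<lbrakk>x \<in> carrier A; y \<in> carrier A\<rbrakk> \<Longrightarrow> f (x \<oplus>\<^bsub>A\<^esub> y) = f x \<oplus>\<^bsub>B\<^esub> f y"
    and "f \<one>\<^bsub>A\<^esub> = \<one>\<^bsub>B\<^esub>"
    and "\<And>a x. \<lbrakk>a \<in> carrier K; x \<in> carrier A\<rbrakk> \<Longrightarrow> f (a \<odot>\<^bsub>A\<^esub> x) = a \<odot>\<^bsub>B\<^esub> f x"
  using assms unfolding alg_hom_def ring_hom_def by auto

lemma alg_hom_comp:
  "\<lbrakk>f \<in> alg_hom K A B; g \<in> alg_hom K B C\<rbrakk> \<Longrightarrow> (\<lambda>x. g (f x)) \<in> alg_hom K A C"
  by (auto intro!: alg_homI simp: alg_homD)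

lemma alg_hom_zero:
  assumes "f \<in> alg_hom K A B" "assoc_algebra K A" "assoc_algebra K B"
  shows "f \<zero>\<^bsub>A\<^esub> = \<zero>\<^bsub>B\<^esub>"
  using ring_hom_zero[of f A B] assms by (auto simp: alg_hom_def assoc_algebra_def)

lemma alg_hom_ring_hom_ring:
  assumes "f \<in> alg_hom K A B" "assoc_algebra K A" "assoc_algebra K B"
  shows "ring_hom_ring A B f"
  by (rule ring_hom_ringI2)
    (use assms in \<open>auto simp: alg_hom_def assoc_algebra_def\<close>)

text \<open>Every axiom is pulled back to \<open>A\<close> along the surjection. As \<open>B\<close>
  is a bare record, its \<open>zero\<close> field is not yet tied to its addition, hence the
  separate premise on zero. This gives the algebra axioms for \<open>alg_quot\<close>.\<close>

lemma assoc_algebra_image: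
  assumes A: "assoc_algebra K A"
    and f: "f \<in> alg_hom K A B" and surj: "f ` carrier A = carrier B"
    and zero: "f \<zero>\<^bsub>A\<^esub> = \<zero>\<^bsub>B\<^esub>"
  shows "assoc_algebra K B"
proof -
  interpret A: assoc_algebra K A by (rule A)
  note f' = alg_homD[OF f]
  note sym_ops = f'(2,3,5)[symmetric]
  have ex: "\<exists>x\<in>carrier A. y = f x" if "y \<in> carrier B" for y
    using that surj by auto
  show ?thesis
  proof (rule assoc_algebraI)
    show "\<exists>y\<in>carrier B. y \<oplus>\<^bsub>B\<^esub> x = \<zero>\<^bsub>B\<^esub>" if "x \<in> carrier B" for x
    proof -
      obtain u where u: "u \<in> carrier A" "x = f u" using ex \<open>x \<in> carrier B\<close> by auto
      have "f (\<ominus>\<^bsub>A\<^esub> u) \<oplus>\<^bsub>B\<^esub> x = \<zero>\<^bsub>B\<^esub>"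
        using u f'(3)[of "\<ominus>\<^bsub>A\<^esub> u" u] zero by (simp add: A.M.l_neg)
      then show ?thesis using u f'(1) by auto
    qed
  qed (auto dest!: ex intro: A.R.cring_axioms
        simp: f'(1) A.M.a_ac A.m_assoc A.l_distr A.r_distr A.smult_l_distr A.smult_r_distr
          A.smult_assoc1 A.smult_mult_left A.smult_mult_right
        simp flip: f'(2,3,4,5) zero)
qed


lemma cring_image:
  assumes "cring A" and f: "f \<in> alg_hom K A B" and surj: "f ` carrier A = carrier B"
    and B: "assoc_algebra K B"
  shows "cring B"
proof -
  interpret A: cring A by fact
  interpret B: assoc_algebra K B by (rule B)
  have "x \<otimes>\<^bsub>B\<^esub> y = y \<otimes>\<^bsub>B\<^esub> x" if "x \<in> carrier B" "y \<in> carrier B" for x y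
    using that A.m_comm unfolding surj[symmetric]
    by (auto simp flip: alg_homD(2)[OF f])
  then show ?thesis
    by (intro cring.intro comm_monoid.intro comm_monoid_axioms.intro B.ring_axioms
        B.monoid_axioms)
qed

text \<open>The generated subalgebra, as an induction principle for identities known on generators.
  Zero needs no rule of its own: in an algebra it is the scalar 0 times the unit.\<close>

inductive_set alg_span for K :: "('k, 'm) ring_scheme" and A :: "('k, 'a, 'n) module_scheme" and G where
  gen: "x \<in> G \<Longrightarrow> x \<in> alg_span K A G"
| one: "\<one>\<^bsub>A\<^esub> \<in> alg_span K A G"
| add: "\<lbrakk>x \<in> alg_span K A G; y \<in> alg_span K A G\<rbrakk> \<Longrightarrow> x \<oplus>\<^bsub>A\<^esub> y \<in> alg_span K A G"
| mult: "\<lbrakk>x \<in> alg_span K A G; y \<in> alg_span K A G\<rbrakk> \<Longrightarrow> x \<otimes>\<^bsub>A\<^esub> y \<in> alg_span K A G"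
| smult: "\<lbrakk>a \<in> carrier K; x \<in> alg_span K A G\<rbrakk> \<Longrightarrow> a \<odot>\<^bsub>A\<^esub> x \<in> alg_span K A G"

text \<open>The elements on which two homomorphisms agree form a subalgebra. All uniqueness claims
  for homomorphisms go through this.\<close>

lemma alg_hom_eqI:
  assumes f: "f \<in> alg_hom K A B" and g: "g \<in> alg_hom K A B"
    and span: "carrier A = alg_span K A G"
    and eq: "\<And>x. x \<in> G \<Longrightarrow> f x = g x" and x: "x \<in> carrier A"
  shows "f x = g x"
proof -
  have "x \<in> alg_span K A G" using x span by simp
  then show ?thesis
    by induction (simp_all add: eq alg_homD[OF f] alg_homD[OF g] flip: span)
qed


section \<open>Quotient algebras\<close>

text \<open>Operations on quotients are encoded as unions over all representatives of a coset. If
  \<open>g\<close> respects the coset, all members of the union are the same coset, and any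
  representative computes it.\<close>

lemma (in ideal) Union_coset:
  assumes "q \<in> carrier R" "\<And>x. x \<in> I +> q \<Longrightarrow> g x \<in> I +> g q" "g q \<in> carrier R"
  shows "(\<Union>x\<in>I +> q. I +> g x) = I +> g q"
proof -
  have "I +> g x = I +> g q" if "x \<in> I +> q" for x
    using a_repr_independence'[OF assms(2)[OF that] assms(3)] by simp
  then have "(\<Union>x\<in>I +> q. I +> g x) = (\<Union>x\<in>I +> q. I +> g q)"
    by (rule SUP_cong[OF refl])
  also have "\<dots> = I +> g q"
    using a_rcos_self[OF assms(1)] by blast
  finally show ?thesis .
qed

lemma (in ideal) the_elem_coset:
  assumes "q \<in> carrier R" "\<And>x. x \<in> I +> q \<Longrightarrow> g x = g q"
  shows "the_elem (g ` (I +> q)) = g q"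
proof -
  have "g ` (I +> q) = {g q}"
    using assms(2) a_rcos_self[OF assms(1)] by (blast intro: sym)
  then show ?thesis by simp
qed

lemma alg_quot_simps:
  "carrier (alg_quot A I) = (\<lambda>x. I +>\<^bsub>A\<^esub> x) ` carrier A"
  "carrier (A Quot I) = (\<lambda>x. I +>\<^bsub>A\<^esub> x) ` carrier A"
  "monoid.mult (alg_quot A I) = rcoset_mult A I"
  "one (alg_quot A I) = I +>\<^bsub>A\<^esub> \<one>\<^bsub>A\<^esub>"
  "zero (alg_quot A I) = I"
  "add (alg_quot A I) = set_add A"
  "smult (alg_quot A I) = (\<lambda>a C. \<Union>x\<in>C. I +>\<^bsub>A\<^esub> (a \<odot>\<^bsub>A\<^esub> x))"
  by (auto simp: alg_quot_def module.defs ring.extend_def FactRing_def A_RCOSETS_def')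

context assoc_algebra
begin

lemma ideal_smult_closed:
  assumes "ideal I A" "a \<in> carrier K" "x \<in> I"
  shows "a \<odot> x \<in> I"
proof -
  interpret ideal I A by fact
  have x: "x \<in> carrier A" using assms(3) a_Hcarr by blast
  have "a \<odot> x = (a \<odot> \<one>) \<otimes> x" using assms(2) x by (simp add: smult_mult_left)
  then show ?thesis using assms I_l_closed x by simp
qed

lemma alg_quot_smult:
  assumes I: "ideal I A" and "a \<in> carrier K" "q \<in> carrier A"
  shows "a \<odot>\<^bsub>alg_quot A I\<^esub> (I +> q) = I +> (a \<odot> q)"
proof -
  interpret ideal I A by fact
  have "a \<odot> x \<in> I +> (a \<odot> q)" if x: "x \<in> I +> q" for x
  proof -
    obtain h where "h \<in> I" "x = h \<oplus> q" using x by (auto simp: a_r_coset_def')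
    then show ?thesis
      using assms ideal_smult_closed[OF I] a_Hcarr[of h]
      by (auto simp: a_r_coset_def' smult_r_distr)
  qed
  then show ?thesis using assms by (simp add: alg_quot_simps Union_coset)
qed

lemma coset_alg_hom:
  assumes I: "ideal I A"
  shows "(\<lambda>x. I +> x) \<in> alg_hom K A (alg_quot A I)"
proof -
  interpret ideal I A by fact
  show ?thesis
    by (rule alg_homI)
      (auto simp: alg_quot_smult[OF I], auto simp: alg_quot_simps rcoset_mult_add a_rcos_sum)
qed

lemma assoc_algebra_alg_quot:
  assumes I: "ideal I A"
  shows "assoc_algebra K (alg_quot A I)"
proof (rule assoc_algebra_image[OF assoc_algebra_axioms coset_alg_hom[OF I]])
  interpret ideal I A by fact
  show "I +> \<zero> = \<zero>\<^bsub>alg_quot A I\<^esub>"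
    by (simp add: alg_quot_simps a_subset)
qed (simp add: alg_quot_simps)

text \<open>\<open>f\<close> is constant on each coset because it kills \<open>I\<close>, so
  \<open>the_elem\<close> picks out the common value. The restriction to the carrier meets the
  normalization demanded by the uniqueness clause of the universal property.\<close>

lemma alg_hom_factor:
  assumes I: "ideal I A" and B: "assoc_algebra K B" and f: "f \<in> alg_hom K A B"
    and ker: "\<And>x. x \<in> I \<Longrightarrow> f x = \<zero>\<^bsub>B\<^esub>"
  obtains g where "g \<in> extensional (carrier (alg_quot A I))" "g \<in> alg_hom K (alg_quot A I) B"
    "\<And>x. x \<in> carrier A \<Longrightarrow> g (I +> x) = f x"
proof
  interpret ideal I A by fact
  interpret B: assoc_algebra K B by fact
  let ?g = "restrict (\<lambda>C. the_elem (f ` C)) (carrier (alg_quot A I))"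
  note \<pi> = alg_homD[OF coset_alg_hom[OF I]] and f' = alg_homD[OF f]
  show g: "?g (I +> x) = f x" if "x \<in> carrier A" for x
  proof -
    have "f y = f x" if y: "y \<in> I +> x" for y
    proof -
      obtain h where "h \<in> I" "y = h \<oplus> x" using y by (auto simp: a_r_coset_def')
      then show ?thesis using \<open>x \<in> carrier A\<close> a_Hcarr[of h] by (simp add: f' ker)
    qed
    then show ?thesis using that by (simp add: \<pi>(1) the_elem_coset)
  qed
  show "?g \<in> alg_hom K (alg_quot A I) B"
  proof (rule alg_homI)
    note ex = alg_quot_simps(1)[of A I]
    fix C C' assume "C \<in> carrier (alg_quot A I)" "C' \<in> carrier (alg_quot A I)"
    then obtain x y where "x \<in> carrier A" "C = I +> x" "y \<in> carrier A" "C' = I +> y"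
      by (auto simp: ex)
    then show "?g (C \<otimes>\<^bsub>alg_quot A I\<^esub> C') = ?g C \<otimes>\<^bsub>B\<^esub> ?g C'"
      "?g (C \<oplus>\<^bsub>alg_quot A I\<^esub> C') = ?g C \<oplus>\<^bsub>B\<^esub> ?g C'"
      by (simp_all add: g f' del: restrict_apply flip: \<pi>(2-5))
  next
    fix C assume "C \<in> carrier (alg_quot A I)"
    then obtain x where x: "x \<in> carrier A" "C = I +> x" by (auto simp: alg_quot_simps)
    then show "?g C \<in> carrier B" by (simp add: g f' del: restrict_apply)
    show "?g (a \<odot>\<^bsub>alg_quot A I\<^esub> C) = a \<odot>\<^bsub>B\<^esub> ?g C" if "a \<in> carrier K" for a
      using x that by (simp add: g f' del: restrict_apply flip: \<pi>(2-5))
  qed (simp add: g f' del: restrict_apply flip: \<pi>(2-5))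
qed (rule restrict_extensional)

end


section \<open>Differential operators\<close>

text \<open>
  The algebra \<open>R[\<epsilon>] / (\<epsilon>\<^sup>2 - l \<epsilon>)\<close>: a linear map \<open>d\<close> is a differential operator of weight
  \<open>l\<close> if and only if \<open>x \<mapsto> x + d x \<epsilon>\<close> is an algebra homomorphism.
\<close>

definition weight_dual :: "'k \<Rightarrow> ('k, 'a, 'n) module_scheme \<Rightarrow> ('k, 'a \<times> 'a) module"
  where "weight_dual l R =
    \<lparr>carrier = carrier R \<times> carrier R,
     monoid.mult = (\<lambda>(a, b) (c, e).
       (a \<otimes>\<^bsub>R\<^esub> c, b \<otimes>\<^bsub>R\<^esub> c \<oplus>\<^bsub>R\<^esub> a \<otimes>\<^bsub>R\<^esub> e \<oplus>\<^bsub>R\<^esub> l \<odot>\<^bsub>R\<^esub> (b \<otimes>\<^bsub>R\<^esub> e))),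
     one = (\<one>\<^bsub>R\<^esub>, \<zero>\<^bsub>R\<^esub>),
     zero = (\<zero>\<^bsub>R\<^esub>, \<zero>\<^bsub>R\<^esub>),
     add = (\<lambda>(a, b) (c, e). (a \<oplus>\<^bsub>R\<^esub> c, b \<oplus>\<^bsub>R\<^esub> e)),
     smult = (\<lambda>k (a, b). (k \<odot>\<^bsub>R\<^esub> a, k \<odot>\<^bsub>R\<^esub> b))\<rparr>"

lemma weight_dual_simps:
  "carrier (weight_dual l R) = carrier R \<times> carrier R"
  "(a, b) \<otimes>\<^bsub>weight_dual l R\<^esub> (c, e) =
    (a \<otimes>\<^bsub>R\<^esub> c, b \<otimes>\<^bsub>R\<^esub> c \<oplus>\<^bsub>R\<^esub> a \<otimes>\<^bsub>R\<^esub> e \<oplus>\<^bsub>R\<^esub> l \<odot>\<^bsub>R\<^esub> (b \<otimes>\<^bsub>R\<^esub> e))"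
  "\<one>\<^bsub>weight_dual l R\<^esub> = (\<one>\<^bsub>R\<^esub>, \<zero>\<^bsub>R\<^esub>)"
  "\<zero>\<^bsub>weight_dual l R\<^esub> = (\<zero>\<^bsub>R\<^esub>, \<zero>\<^bsub>R\<^esub>)"
  "(a, b) \<oplus>\<^bsub>weight_dual l R\<^esub> (c, e) = (a \<oplus>\<^bsub>R\<^esub> c, b \<oplus>\<^bsub>R\<^esub> e)"
  "k \<odot>\<^bsub>weight_dual l R\<^esub> (a, b) = (k \<odot>\<^bsub>R\<^esub> a, k \<odot>\<^bsub>R\<^esub> b)"
  by (simp_all add: weight_dual_def)

context assoc_algebra
begin

lemma smult_left_commute:
  "\<lbrakk>a \<in> carrier K; b \<in> carrier K; x \<in> carrier A\<rbrakk> \<Longrightarrow> a \<odot> (b \<odot> x) = b \<odot> (a \<odot> x)"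
  by (metis smult_assoc1 R.m_comm)

lemma assoc_algebra_weight_dual:
  assumes l: "l \<in> carrier K"
  shows "assoc_algebra K (weight_dual l A)"
proof (rule assoc_algebraI)
  show "\<exists>y\<in>carrier (weight_dual l A). y \<oplus>\<^bsub>weight_dual l A\<^esub> x = \<zero>\<^bsub>weight_dual l A\<^esub>"
    if "x \<in> carrier (weight_dual l A)" for x
    using that by (intro bexI[of _ "(\<ominus> fst x, \<ominus> snd x)"])
      (auto simp: weight_dual_simps l_neg)
qed (auto simp: weight_dual_simps l M.a_ac m_assoc l_distr r_distr smult_l_distr smult_r_distr
    smult_assoc1 smult_mult_left smult_mult_right smult_left_commute R.cring_axioms)

text \<open>Commutative polynomials extend only to commutative targets, so the construction of
  \<open>comm_diff_op\<close> needs the dual algebra to be commutative.\<close>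

lemma cring_weight_dual:
  assumes l: "l \<in> carrier K" and "cring A"
  shows "cring (weight_dual l A)"
proof -
  interpret A: cring A by fact
  interpret W: assoc_algebra K "weight_dual l A" by (rule assoc_algebra_weight_dual[OF l])
  have "x \<otimes>\<^bsub>weight_dual l A\<^esub> y = y \<otimes>\<^bsub>weight_dual l A\<^esub> x"
    if "x \<in> carrier (weight_dual l A)" "y \<in> carrier (weight_dual l A)" for x y
    using that by (auto simp: weight_dual_simps l M.a_ac A.m_ac)
  then show ?thesis
    by (intro cring.intro comm_monoid.intro comm_monoid_axioms.intro W.ring_axioms
        W.monoid_axioms)
qed

text \<open>The product rule expresses the derivative of a product through the factors and their
  derivatives, so the agreement set of two operators is a subalgebra although the operators are not
  multiplicative.\<close>

lemma diff_op_eqI: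
  assumes d: "differential_algebra K l A d" and e: "differential_algebra K l A e"
    and span: "carrier A = alg_span K A G"
    and eq: "\<And>x. x \<in> G \<Longrightarrow> d x = e x" and x: "x \<in> carrier A"
  shows "d x = e x"
proof -
  interpret d: differential_algebra K l A d by (rule d)
  interpret e: differential_algebra K l A e by (rule e)
  have "x \<in> alg_span K A G" using x span by simp
  then show ?thesis
    by induction (simp_all add: eq d.d_add d.d_smult d.d_mult d.d_one e.d_add e.d_smult
        e.d_mult e.d_one flip: span)
qed

text \<open>\<open>ext\<close> supplies the homomorphism x + d(x) \<epsilon> with prescribed values
  on generators, and the operator is read off as its second component. In the application
  \<open>s\<close> raises the order of derivation by one.\<close>

lemma diff_op_ex1:
  fixes h :: "'i \<Rightarrow> 'c" and s :: "'i \<Rightarrow> 'i"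
  assumes l: "l \<in> carrier K"
    and span: "carrier A = alg_span K A (h ` Y)"
    and s: "\<And>y. y \<in> Y \<Longrightarrow> s y \<in> Y"
    and ext: "\<exists>\<Phi>\<in>alg_hom K A (weight_dual l A). \<forall>y\<in>Y. \<Phi> (h y) = (h y, h (s y))"
  shows "\<exists>!d. d \<in> extensional (carrier A) \<and> differential_algebra K l A d \<and>
    (\<forall>y\<in>Y. d (h y) = h (s y))"
proof -
  obtain \<Phi> where \<Phi>: "\<Phi> \<in> alg_hom K A (weight_dual l A)"
    and \<Phi>_gen: "\<And>y. y \<in> Y \<Longrightarrow> \<Phi> (h y) = (h y, h (s y))"
    using ext by auto
  note \<Phi>' = alg_homD[OF \<Phi>]
  define d where "d = restrict (\<lambda>x. snd (\<Phi> x)) (carrier A)"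
  have h: "h y \<in> carrier A" if "y \<in> Y" for y
    unfolding span using that by (auto intro: alg_span.gen)
  have fst_hom: "fst \<in> alg_hom K (weight_dual l A) A"
    by (rule alg_homI) (auto simp: weight_dual_simps)
  \<comment> \<open>\<open>fst\<close> composed with \<Phi> and the identity are two endomorphisms
    of \<open>A\<close> that agree on the generators.\<close>
  have "fst (\<Phi> x) = x" if "x \<in> carrier A" for x
    by (rule alg_hom_eqI[OF alg_hom_comp[OF \<Phi> fst_hom] alg_homI[of A "\<lambda>x. x" A K] span _ that])
      (auto simp: \<Phi>_gen)
  then have \<Phi>_eq: "\<Phi> x = (x, d x)" if "x \<in> carrier A" for x
    using that by (metis d_def prod.collapse restrict_apply')
  have d_gen: "d (h y) = h (s y)" if "y \<in> Y" for y
    using \<Phi>_eq[OF h[OF that]] \<Phi>_gen[OF that] by simp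
  \<comment> \<open>The second components of the homomorphism laws for \<Phi> are exactly the
    operator axioms; the derivative of one vanishes because the unit of \<open>weight_dual\<close>
    is \<open>(\<one>, \<zero>)\<close>.\<close>
  have diff: "differential_algebra K l A d"
  proof (intro differential_algebra.intro differential_algebra_axioms.intro assoc_algebra_axioms l)
    show "d x \<in> carrier A" if "x \<in> carrier A" for x
      using \<Phi>'(1)[OF that] that by (simp add: \<Phi>_eq weight_dual_simps)
  qed (use \<Phi>'(2-5) in \<open>auto simp: \<Phi>_eq weight_dual_simps\<close>)
  show ?thesis
  proof (rule ex1I[of _ d])
    show "d \<in> extensional (carrier A) \<and> differential_algebra K l A d \<and>
      (\<forall>y\<in>Y. d (h y) = h (s y))"
      using diff d_gen by (simp add: d_def)
    fix e assume e: "e \<in> extensional (carrier A) \<and> differential_algebra K l A e \<and>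
      (\<forall>y\<in>Y. e (h y) = h (s y))"
    show "e = d"
    proof (rule extensionalityI)
      show "e x = d x" if "x \<in> carrier A" for x
        using e d_gen by (intro diff_op_eqI[OF _ diff span _ that]) auto
    qed (use e in \<open>auto simp: d_def\<close>)
  qed
qed

end


section \<open>Differential ideals, their quotients, and homomorphisms commuting with the
  operators\<close>

context differential_algebra
begin

lemma d_zero: "d \<zero> = \<zero>"
  using d_smult[of "\<zero>\<^bsub>K\<^esub>" \<zero>] d_closed by simp

lemma diff_quot_coset:
  assumes J: "differential_ideal J R d" and q: "q \<in> carrier R"
  shows "diff_quot R d J (J +> q) = J +> d q"
proof -
  interpret ideal J R using J by (simp add: differential_ideal_def)
  have "d x \<in> J +> d q" if x: "x \<in> J +> q" for x
  proof -
    obtain h where h: "h \<in> J" "x = h \<oplus> q" using x by (auto simp: a_r_coset_def')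
    then have "d h \<in> J" using J by (auto simp: differential_ideal_def)
    then show ?thesis using h q a_Hcarr[of h] by (auto simp: a_r_coset_def' d_add)
  qed
  then show ?thesis using q d_closed by (simp add: diff_quot_def Union_coset)
qed

text \<open>On representatives the induced operator is \<open>d\<close> itself, so each axiom is the
  image of the corresponding axiom of \<open>R\<close> under the coset homomorphism.\<close>

lemma differential_algebra_diff_quot:
  assumes J: "differential_ideal J R d"
  shows "differential_algebra K l (alg_quot R J) (diff_quot R d J)"
proof -
  have idl: "ideal J R" using J by (simp add: differential_ideal_def)
  note \<pi> = alg_homD[OF coset_alg_hom[OF idl]]
  have ex: "\<exists>x\<in>carrier R. C = J +> x" if "C \<in> carrier (alg_quot R J)" for C
    using that by (auto simp: alg_quot_simps)
  have zero: "J +> \<zero> = \<zero>\<^bsub>alg_quot R J\<^esub>"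
    by (rule alg_hom_zero[OF coset_alg_hom[OF idl] assoc_algebra_axioms
          assoc_algebra_alg_quot[OF idl]])
  show ?thesis
    by (intro differential_algebra.intro differential_algebra_axioms.intro
        assoc_algebra_alg_quot[OF idl] weight_closed)
      (auto dest!: ex simp: diff_quot_coset[OF J] d_closed d_add d_smult d_mult d_one weight_closed
        \<pi>(1) zero[symmetric] simp flip: \<pi>(2-5))
qed

lemma diff_genideal_ideal:
  assumes U: "U \<subseteq> carrier R"
  shows "differential_ideal (diff_genideal R d U) R d" and "U \<subseteq> diff_genideal R d U"
proof -
  \<comment> \<open>The whole ring keeps the intersected family nonempty; an empty intersection
    would be the universe of the type.\<close>
  have "differential_ideal (carrier R) R d"
    using oneideal d_closed by (auto simp: differential_ideal_def)
  then have "ideal (diff_genideal R d U) R"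
    unfolding diff_genideal_def using U
    by (intro i_Intersect) (auto simp: differential_ideal_def)
  then show "differential_ideal (diff_genideal R d U) R d"
    by (auto simp: differential_ideal_def diff_genideal_def)
  show "U \<subseteq> diff_genideal R d U"
    by (auto simp: diff_genideal_def)
qed

text \<open>The kernel of \<open>f\<close> is a member of the family whose intersection is
  \<open>diff_genideal\<close>: if \<open>f x\<close> is zero, then f(d x) = e(f x) = e(0) =
  0.\<close>

lemma diff_genideal_kernel:
  assumes S: "differential_algebra K l S e" and f: "f \<in> diff_alg_hom K R d S e"
    and U: "U \<subseteq> carrier R" "\<And>u. u \<in> U \<Longrightarrow> f u = \<zero>\<^bsub>S\<^esub>"
    and x: "x \<in> diff_genideal R d U"
  shows "f x = \<zero>\<^bsub>S\<^esub>"
proof -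
  interpret S: differential_algebra K l S e by (rule S)
  have f': "f \<in> alg_hom K R S" "\<And>x. x \<in> carrier R \<Longrightarrow> f (d x) = e (f x)"
    using f by (auto simp: diff_alg_hom_def)
  interpret f: ring_hom_ring R S f
    by (rule alg_hom_ring_hom_ring[OF f'(1) assoc_algebra_axioms S.assoc_algebra_axioms])
  have "d x \<in> a_kernel R S f" if "x \<in> a_kernel R S f" for x
  proof -
    have "x \<in> carrier R" "f x = \<zero>\<^bsub>S\<^esub>" using that unfolding a_kernel_def' by blast+
    then have "f (d x) = \<zero>\<^bsub>S\<^esub>" by (metis f'(2) S.d_zero)
    then show ?thesis using d_closed[OF \<open>x \<in> carrier R\<close>] unfolding a_kernel_def' by blast
  qed
  then have "differential_ideal (a_kernel R S f) R d"
    unfolding differential_ideal_def using f.kernel_is_ideal by blast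
  moreover have "U \<subseteq> a_kernel R S f" using U unfolding a_kernel_def' by blast
  ultimately have "x \<in> a_kernel R S f" using x unfolding diff_genideal_def by blast
  then show ?thesis unfolding a_kernel_def' by blast
qed

text \<open>Write D for f after d, or for e after f. Both satisfy D(xy) = D(x) f(y) + f(x) D(y) + l
  D(x) D(y) and D(1) = 0, so their agreement passes from generators to the whole span.\<close>

lemma alg_hom_diff_alg_hom:
  assumes S: "differential_algebra K l S e" and f: "f \<in> alg_hom K R S"
    and span: "carrier R = alg_span K R G"
    and gen: "\<And>x. x \<in> G \<Longrightarrow> f (d x) = e (f x)"
  shows "f \<in> diff_alg_hom K R d S e"
proof -
  interpret S: differential_algebra K l S e by (rule S)
  note f' = alg_homD[OF f]
  have zero: "f \<zero> = \<zero>\<^bsub>S\<^esub>"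
    by (rule alg_hom_zero[OF f assoc_algebra_axioms S.assoc_algebra_axioms])
  have "f (d x) = e (f x)" if "x \<in> alg_span K R G" for x
    using that
    by induction (simp_all add: gen f' zero d_closed d_add d_smult d_mult d_one weight_closed
        S.d_add S.d_smult S.d_mult S.d_one flip: span)
  then show ?thesis using f span by (simp add: diff_alg_hom_def)
qed

end


section \<open>Presentations\<close>

text \<open>The data common to the commutative and the noncommutative case: \<open>P\<close> is
  generated by \<xi>, \<open>Q\<close> by \<eta>, and \<open>d\<close> shifts the generators of
  \<open>Q\<close>. Freeness of \<open>Q\<close> is kept out of the locale because it holds for
  different classes of targets in the two cases.\<close>

locale diff_presentation =
  P: assoc_algebra K P + Q: differential_algebra K l Q d
  for K :: "('k, 'm) ring_scheme" and l and P :: "('k, 'p) module" and Q :: "('k, 'q) module" and d +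
  fixes X :: "'x set" and \<xi> :: "'x \<Rightarrow> 'p" and \<eta> :: "'x \<times> nat \<Rightarrow> 'q" and \<iota> :: "'p \<Rightarrow> 'q"
    and I :: "'p set" and A :: "('k, 'a) module" and \<theta> :: "'p set \<Rightarrow> 'a"
  assumes span_P: "carrier P = alg_span K P (\<xi> ` X)"
    and span_Q: "carrier Q = alg_span K Q (\<eta> ` Delta X)"
    and d_gen: "\<And>x n. x \<in> X \<Longrightarrow> d (\<eta> (x, n)) = \<eta> (x, Suc n)"
    and \<iota>_hom: "\<iota> \<in> alg_hom K P Q"
    and \<iota>_gen: "\<And>x. x \<in> X \<Longrightarrow> \<iota> (\<xi> x) = \<eta> (x, 0)"
    and ideal_I: "ideal I P"
    and \<theta>_iso: "\<theta> \<in> alg_iso K (alg_quot P I) A"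
begin

definition J :: "'q set" where "J = diff_genideal Q d (\<iota> ` I)"

definition i :: "'a \<Rightarrow> 'q set" where "i = induced_map P I \<theta> Q J \<iota>"

sublocale I: ideal I P by (rule ideal_I)

lemma \<iota>_image: "\<iota> ` I \<subseteq> carrier Q"
  using alg_homD(1)[OF \<iota>_hom] I.a_Hcarr by auto

lemma diff_ideal_J: "differential_ideal J Q d" and \<iota>_J: "x \<in> I \<Longrightarrow> \<iota> x \<in> J"
  unfolding J_def using Q.diff_genideal_ideal[OF \<iota>_image] by auto

sublocale J: ideal J Q using diff_ideal_J by (simp add: differential_ideal_def)

lemma \<xi>_closed: "x \<in> X \<Longrightarrow> \<xi> x \<in> carrier P"
  unfolding span_P by (auto intro: alg_span.gen)

lemma \<eta>_closed: "x \<in> X \<Longrightarrow> \<eta> (x, n) \<in> carrier Q"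
  unfolding span_Q by (auto intro!: alg_span.gen simp: Delta_def)

lemma \<theta>_hom: "\<theta> \<in> alg_hom K (alg_quot P I) A"
  and \<theta>_bij: "bij_betw \<theta> (carrier (alg_quot P I)) (carrier A)"
  using \<theta>_iso by (auto simp: alg_iso_def)

lemma \<theta>_coset_hom: "(\<lambda>f. \<theta> (I +>\<^bsub>P\<^esub> f)) \<in> alg_hom K P A"
  by (rule alg_hom_comp[OF P.coset_alg_hom[OF ideal_I] \<theta>_hom])

lemma \<theta>_coset_surj:
  assumes "a \<in> carrier A"
  obtains f where "f \<in> carrier P" "a = \<theta> (I +>\<^bsub>P\<^esub> f)"
  using assms bij_betw_imp_surj_on[OF \<theta>_bij] by (auto simp: alg_quot_simps)

text \<open>Injectivity of \<theta> recovers the coset of \<open>f\<close>, and \<iota> carries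
  \<open>I\<close> into \<open>J\<close>, so the choice of representative does not matter. Later
  steps evaluate the structure map only through this formula.\<close>

lemma i_\<theta>:
  assumes f: "f \<in> carrier P"
  shows "i (\<theta> (I +>\<^bsub>P\<^esub> f)) = J +>\<^bsub>Q\<^esub> \<iota> f"
proof -
  note \<iota>' = alg_homD[OF \<iota>_hom]
  have "inv_into (carrier (P Quot I)) \<theta> (\<theta> (I +>\<^bsub>P\<^esub> f)) = I +>\<^bsub>P\<^esub> f"
    using f bij_betw_imp_inj_on[OF \<theta>_bij] by (simp add: alg_quot_simps inv_into_f_f)
  moreover have "J +>\<^bsub>Q\<^esub> \<iota> g = J +>\<^bsub>Q\<^esub> \<iota> f" if g: "g \<in> I +>\<^bsub>P\<^esub> f" for g
  proof -
    obtain h where h: "h \<in> I" "g = h \<oplus>\<^bsub>P\<^esub> f" using g by (auto simp: a_r_coset_def')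
    then have "\<iota> g \<in> J +>\<^bsub>Q\<^esub> \<iota> f"
      using f I.a_Hcarr[of h] \<iota>_J by (auto simp: a_r_coset_def' \<iota>')
    then show ?thesis
      using J.a_repr_independence'[of "\<iota> g" "\<iota> f"] f \<iota>' by simp
  qed
  ultimately show ?thesis
    using I.the_elem_coset[OF f, of "\<lambda>f. J +>\<^bsub>Q\<^esub> \<iota> f"] by (simp add: i_def induced_map_def)
qed

lemma coset_hom: "(\<lambda>q. J +>\<^bsub>Q\<^esub> q) \<in> alg_hom K Q (alg_quot Q J)"
  by (rule Q.coset_alg_hom[OF J.ideal_axioms])

lemma i_hom: "i \<in> alg_hom K A (alg_quot Q J)"
proof (rule alg_homI)
  note \<theta>' = alg_homD[OF \<theta>_coset_hom]
  note \<rho> = alg_homD[OF alg_hom_comp[OF \<iota>_hom coset_hom]]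
  show "i \<one>\<^bsub>A\<^esub> = \<one>\<^bsub>alg_quot Q J\<^esub>"
    using \<rho>(4) i_\<theta> \<theta>'(4) P.one_closed by metis
  fix a b assume "a \<in> carrier A" "b \<in> carrier A"
  then obtain f g where fg: "f \<in> carrier P" "a = \<theta> (I +>\<^bsub>P\<^esub> f)"
    "g \<in> carrier P" "b = \<theta> (I +>\<^bsub>P\<^esub> g)" by (metis \<theta>_coset_surj)
  then show "i (a \<otimes>\<^bsub>A\<^esub> b) = i a \<otimes>\<^bsub>alg_quot Q J\<^esub> i b"
    "i (a \<oplus>\<^bsub>A\<^esub> b) = i a \<oplus>\<^bsub>alg_quot Q J\<^esub> i b"
    \<comment> \<open>Operations in \<open>A\<close> are read backwards as images of operations in
      \<open>P\<close>, where \<open>i_\<theta>\<close> applies.\<close>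
    by (simp_all add: i_\<theta> \<rho> flip: \<theta>'(2-5))
next
  fix a assume "a \<in> carrier A"
  then obtain f where f: "f \<in> carrier P" "a = \<theta> (I +>\<^bsub>P\<^esub> f)" by (metis \<theta>_coset_surj)
  note \<theta>' = alg_homD[OF \<theta>_coset_hom]
  note \<rho> = alg_homD[OF alg_hom_comp[OF \<iota>_hom coset_hom]]
  show "i a \<in> carrier (alg_quot Q J)" using f by (simp add: i_\<theta> \<rho>)
  show "i (k \<odot>\<^bsub>A\<^esub> a) = k \<odot>\<^bsub>alg_quot Q J\<^esub> i a" if "k \<in> carrier K" for k
    using f that by (simp add: i_\<theta> \<rho> flip: \<theta>'(2-5))
qed

text \<open>The premise \<open>ext\<close> is the freeness of \<open>Q\<close> as an algebra
  relative to the single target \<open>R\<close>; it is used for one assignment \<open>g\<close> of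
  values to generators.\<close>

lemma universal_property:
  fixes R :: "('k, 'r) module"
  assumes R: "differential_algebra K l R e" and \<phi>: "\<phi> \<in> alg_hom K A R"
    and ext: "\<And>g. g \<in> Delta X \<rightarrow> carrier R \<Longrightarrow> \<exists>\<Psi>\<in>alg_hom K Q R. \<forall>y\<in>Delta X. \<Psi> (\<eta> y) = g y"
  shows "\<exists>!\<psi>. \<psi> \<in> extensional (carrier (alg_quot Q J)) \<and>
    \<psi> \<in> diff_alg_hom K (alg_quot Q J) (diff_quot Q d J) R e \<and> (\<forall>a\<in>carrier A. \<phi> a = \<psi> (i a))"
proof -
  interpret R: differential_algebra K l R e by (rule R)
  note \<phi>\<theta> = alg_hom_comp[OF \<theta>_coset_hom \<phi>]
  \<comment> \<open>The only possible choice: compatibility with \<phi> fixes the value at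
    \<open>(x, 0)\<close>, and commutation with the operators then forces its n-th derivative at
    \<open>(x, n)\<close>.\<close>
  define g where "g = (\<lambda>(x, n). (e ^^ n) (\<phi> (\<theta> (I +>\<^bsub>P\<^esub> \<xi> x))))"
  have g_Suc: "g (x, Suc n) = e (g (x, n))" for x n by (simp add: g_def)
  have "(e ^^ n) r \<in> carrier R" if "r \<in> carrier R" for n r
    using that by (induction n) (auto simp: R.d_closed)
  then have "g \<in> Delta X \<rightarrow> carrier R"
    using alg_homD(1)[OF \<phi>\<theta>] \<xi>_closed by (auto simp: g_def Delta_def)
  then obtain \<Psi> where \<Psi>: "\<Psi> \<in> alg_hom K Q R" and "\<forall>y\<in>Delta X. \<Psi> (\<eta> y) = g y"
    using ext by blast
  then have \<Psi>_gen: "\<Psi> (\<eta> (x, n)) = g (x, n)" if "x \<in> X" for x n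
    using that by (simp add: Delta_def)
  have \<Psi>_diff: "\<Psi> \<in> diff_alg_hom K Q d R e"
    by (rule Q.alg_hom_diff_alg_hom[OF R \<Psi> span_Q])
      (auto simp: Delta_def d_gen \<Psi>_gen g_Suc)
  have \<Psi>_\<iota>: "\<Psi> (\<iota> f) = \<phi> (\<theta> (I +>\<^bsub>P\<^esub> f))" if "f \<in> carrier P" for f
    by (rule alg_hom_eqI[OF alg_hom_comp[OF \<iota>_hom \<Psi>] \<phi>\<theta> span_P _ that])
      (auto simp: \<iota>_gen \<Psi>_gen g_def)
  have "\<Psi> (\<iota> f) = \<zero>\<^bsub>R\<^esub>" if "f \<in> I" for f
  proof -
    have "I +>\<^bsub>P\<^esub> f = I +>\<^bsub>P\<^esub> \<zero>\<^bsub>P\<^esub>"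
      using P.a_rcos_zero[OF ideal_I] that by auto
    then show ?thesis
      using alg_hom_zero[OF \<phi>\<theta> P.assoc_algebra_axioms R.assoc_algebra_axioms] \<Psi>_\<iota> that I.a_Hcarr
      by metis
  qed
  \<comment> \<open>Vanishing was checked only on the image of \<open>I\<close>; it spreads to the
    generated differential ideal because \<Psi> commutes with the operators.\<close>
  then have "\<Psi> q = \<zero>\<^bsub>R\<^esub>" if "q \<in> J" for q
    using Q.diff_genideal_kernel[OF R \<Psi>_diff \<iota>_image] that by (auto simp: J_def)
  then obtain \<psi> where \<psi>: "\<psi> \<in> extensional (carrier (alg_quot Q J))"
    "\<psi> \<in> alg_hom K (alg_quot Q J) R" and \<psi>_coset: "\<And>q. q \<in> carrier Q \<Longrightarrow> \<psi> (J +>\<^bsub>Q\<^esub> q) = \<Psi> q"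
    using Q.alg_hom_factor[OF J.ideal_axioms R.assoc_algebra_axioms \<Psi>] by metis
  have "\<psi> (diff_quot Q d J C) = e (\<psi> C)" if "C \<in> carrier (alg_quot Q J)" for C
    using that \<Psi>_diff
    by (auto simp: alg_quot_simps Q.diff_quot_coset[OF diff_ideal_J] \<psi>_coset Q.d_closed
        diff_alg_hom_def)
  then have \<psi>_diff: "\<psi> \<in> diff_alg_hom K (alg_quot Q J) (diff_quot Q d J) R e"
    using \<psi>(2) by (simp add: diff_alg_hom_def)
  have \<psi>_i: "\<phi> a = \<psi> (i a)" if a: "a \<in> carrier A" for a
  proof -
    obtain f where "f \<in> carrier P" "a = \<theta> (I +>\<^bsub>P\<^esub> f)" using a by (rule \<theta>_coset_surj)
    then show ?thesis by (simp add: i_\<theta> \<psi>_coset \<Psi>_\<iota> alg_homD(1)[OF \<iota>_hom])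
  qed
  show ?thesis
  proof (rule ex1I[of _ \<psi>])
    fix \<psi>' assume \<psi>': "\<psi>' \<in> extensional (carrier (alg_quot Q J)) \<and>
      \<psi>' \<in> diff_alg_hom K (alg_quot Q J) (diff_quot Q d J) R e \<and> (\<forall>a\<in>carrier A. \<phi> a = \<psi>' (i a))"
    then have hom': "\<psi>' \<in> alg_hom K (alg_quot Q J) R"
      and comm': "\<And>C. C \<in> carrier (alg_quot Q J) \<Longrightarrow> \<psi>' (diff_quot Q d J C) = e (\<psi>' C)"
      by (auto simp: diff_alg_hom_def)
    \<comment> \<open>The order zero values come from the compatibility with \<phi>, the higher ones
      from commutation with the operators. Two homomorphisms on \<open>Q\<close> are then compared,
      which settles every coset.\<close>
    have gen': "\<psi>' (J +>\<^bsub>Q\<^esub> \<eta> (x, n)) = g (x, n)" if x: "x \<in> X" for x n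
    proof (induction n)
      case 0
      have "\<phi> (\<theta> (I +>\<^bsub>P\<^esub> \<xi> x)) = \<psi>' (i (\<theta> (I +>\<^bsub>P\<^esub> \<xi> x)))"
        using \<psi>' alg_homD(1)[OF \<theta>_coset_hom] \<xi>_closed[OF x] by blast
      then show ?case using x by (simp add: i_\<theta> \<xi>_closed \<iota>_gen g_def)
    next
      case (Suc n)
      have "\<psi>' (J +>\<^bsub>Q\<^esub> d (\<eta> (x, n))) = e (\<psi>' (J +>\<^bsub>Q\<^esub> \<eta> (x, n)))"
        using comm'[OF alg_homD(1)[OF coset_hom \<eta>_closed[OF x]]] x
        by (simp add: Q.diff_quot_coset[OF diff_ideal_J] \<eta>_closed)
      then show ?case using Suc x by (simp add: d_gen g_Suc)
    qed
    have eq: "\<psi>' (J +>\<^bsub>Q\<^esub> q) = \<Psi> q" if "q \<in> carrier Q" for q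
      by (rule alg_hom_eqI[OF alg_hom_comp[OF coset_hom hom'] \<Psi> span_Q _ that])
        (auto simp: Delta_def gen' \<Psi>_gen)
    show "\<psi>' = \<psi>"
    proof (rule extensionalityI)
      show "\<psi>' C = \<psi> C" if "C \<in> carrier (alg_quot Q J)" for C
        using that eq \<psi>_coset by (auto simp: alg_quot_simps)
    qed (use \<psi>' \<psi> in auto)
  qed (use \<psi> \<psi>_diff \<psi>_i in blast)
qed

end


section \<open>Monoid algebras\<close>

locale monoid_algebra_over = K: cring K + M: Group.monoid M
  for K :: "('k, 'm) ring_scheme" (structure) and M :: "('w, 'n) monoid_scheme"
begin

abbreviation KM :: "('k, 'w \<Rightarrow> 'k) module" where "KM \<equiv> monoid_algebra K M"

abbreviation supp :: "('w \<Rightarrow> 'k) \<Rightarrow> 'w set" where "supp f \<equiv> {w. f w \<noteq> \<zero>}"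

lemma KM_simps:
  "f \<in> carrier KM \<longleftrightarrow> (\<forall>w. f w \<in> carrier K) \<and> (\<forall>w. w \<notin> carrier M \<longrightarrow> f w = \<zero>) \<and> finite (supp f)"
  "\<one>\<^bsub>KM\<^esub> = monomial K \<one>\<^bsub>M\<^esub>"
  "\<zero>\<^bsub>KM\<^esub> = (\<lambda>w. \<zero>)"
  "f \<oplus>\<^bsub>KM\<^esub> g = (\<lambda>w. f w \<oplus> g w)"
  "a \<odot>\<^bsub>KM\<^esub> f = (\<lambda>w. a \<otimes> f w)"
  by (simp_all add: monoid_algebra_def monomial_def)

lemma KM_D:
  assumes "f \<in> carrier KM"
  shows "f w \<in> carrier K" "w \<notin> carrier M \<Longrightarrow> f w = \<zero>" "finite (supp f)" "supp f \<subseteq> carrier M"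
  using assms by (auto simp: KM_simps)

lemma KM_I:
  "\<lbrakk>\<And>w. f w \<in> carrier K; supp f \<subseteq> carrier M; finite (supp f)\<rbrakk> \<Longrightarrow> f \<in> carrier KM"
  by (auto simp: KM_simps)

lemma monomial_closed: "w \<in> carrier M \<Longrightarrow> monomial K w \<in> carrier KM"
  by (auto simp: KM_simps monomial_def intro: finite_subset[of _ "{w}"])

lemma zero_closed: "\<zero>\<^bsub>KM\<^esub> \<in> carrier KM"
  by (simp add: KM_simps)

lemma supp_add: "supp (f \<oplus>\<^bsub>KM\<^esub> g) \<subseteq> supp f \<union> supp g"
  by (auto simp: KM_simps)

lemma supp_smult: "a \<in> carrier K \<Longrightarrow> supp (a \<odot>\<^bsub>KM\<^esub> f) \<subseteq> supp f"
  by (auto simp: KM_simps)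

lemma supp_monomial: "supp (monomial K w) \<subseteq> {w}"
  by (auto simp: monomial_def)

lemma add_closed:
  assumes "f \<in> carrier KM" "g \<in> carrier KM"
  shows "f \<oplus>\<^bsub>KM\<^esub> g \<in> carrier KM"
proof -
  have "finite (supp (f \<oplus>\<^bsub>KM\<^esub> g))"
    using finite_subset[OF supp_add] KM_D(3) assms by blast
  then show ?thesis using assms by (simp add: KM_simps)
qed

lemma smult_closed:
  assumes "a \<in> carrier K" "f \<in> carrier KM"
  shows "a \<odot>\<^bsub>KM\<^esub> f \<in> carrier KM"
proof -
  have "finite (supp (a \<odot>\<^bsub>KM\<^esub> f))"
    using finite_subset[OF supp_smult] KM_D(3) assms by blast
  then show ?thesis using assms by (simp add: KM_simps)
qed

text \<open>Induction on the size of the support, peeling off one term at a time. It reduces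
  multilinear identities to monomials.\<close>

lemma KM_induct [consumes 1, case_names zero add]:
  assumes f: "f \<in> carrier KM"
    and zero: "P \<zero>\<^bsub>KM\<^esub>"
    and add: "\<And>a w f. \<lbrakk>a \<in> carrier K; w \<in> carrier M; f \<in> carrier KM; P f\<rbrakk> \<Longrightarrow>
      P (a \<odot>\<^bsub>KM\<^esub> monomial K w \<oplus>\<^bsub>KM\<^esub> f)"
  shows "P f"
  using KM_D(3)[OF f] f
proof (induction "supp f" arbitrary: f rule: finite_induct)
  case empty
  then have "f = \<zero>\<^bsub>KM\<^esub>" by (auto simp: KM_simps)
  then show ?case using zero by simp
next
  case (insert w S)
  note fK = KM_D(1)[OF insert.prems]
  \<comment> \<open>Clearing the coefficient at \<open>w\<close> leaves exactly the smaller support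
    \<open>S\<close>.\<close>
  define g where "g = f(w := \<zero>)"
  have S: "S = supp g"
    using insert.hyps(2,4) by (auto simp: g_def)
  have w: "w \<in> carrier M" using insert.hyps(4) insert.prems by (auto simp: KM_simps)
  have g: "g \<in> carrier KM"
    using insert.prems insert.hyps(1) S by (auto simp: KM_simps g_def)
  have "f = f w \<odot>\<^bsub>KM\<^esub> monomial K w \<oplus>\<^bsub>KM\<^esub> g"
    using fK by (auto simp: KM_simps g_def monomial_def)
  then show ?case
    using add[OF fK w g insert.hyps(3)[OF S g]] by metis
qed

text \<open>The defining sum runs over pairs that depend on \<open>f\<close>, \<open>g\<close> and
  \<open>w\<close>. Moving the condition into the summand allows any finite rectangle containing the
  supports, so that products of different functions can be compared termwise over one index
  set.\<close>

lemma mult_eq: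
  assumes f: "f \<in> carrier KM" and g: "g \<in> carrier KM"
    and A: "finite A" "supp f \<subseteq> A" and B: "finite B" "supp g \<subseteq> B"
  shows "(f \<otimes>\<^bsub>KM\<^esub> g) w =
    (\<Oplus>p\<in>A \<times> B. if fst p \<otimes>\<^bsub>M\<^esub> snd p = w then f (fst p) \<otimes> g (snd p) else \<zero>)"
proof -
  note fK = KM_D(1)[OF f] and gK = KM_D(1)[OF g]
  let ?S = "{(u, v). f u \<noteq> \<zero> \<and> g v \<noteq> \<zero> \<and> u \<otimes>\<^bsub>M\<^esub> v = w}"
  have "(f \<otimes>\<^bsub>KM\<^esub> g) w = finsum K (\<lambda>(u, v). f u \<otimes> g v) ?S"
    by (simp add: monoid_algebra_def)
  also have "\<dots> = (\<Oplus>p\<in>A \<times> B. if fst p \<otimes>\<^bsub>M\<^esub> snd p = w then f (fst p) \<otimes> g (snd p) else \<zero>)"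
  proof (rule K.add.finprod_mono_neutral_cong_left)
    show "?S \<subseteq> A \<times> B" using A B by auto
    show "(if fst p \<otimes>\<^bsub>M\<^esub> snd p = w then f (fst p) \<otimes> g (snd p) else \<zero>) = \<zero>"
      if "p \<in> A \<times> B - ?S" for p
      using that fK gK by (cases p) (auto simp: K.l_null K.r_null)
  qed (use A B fK gK in auto)
  finally show ?thesis .
qed

lemma mult_closed:
  assumes f: "f \<in> carrier KM" and g: "g \<in> carrier KM"
  shows "f \<otimes>\<^bsub>KM\<^esub> g \<in> carrier KM"
proof -
  note fK = KM_D(1)[OF f] and gK = KM_D(1)[OF g]
  let ?T = "(\<lambda>(u, v). u \<otimes>\<^bsub>M\<^esub> v) ` (supp f \<times> supp g)"
  have eq: "(f \<otimes>\<^bsub>KM\<^esub> g) w = (\<Oplus>p\<in>supp f \<times> supp g.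
      if fst p \<otimes>\<^bsub>M\<^esub> snd p = w then f (fst p) \<otimes> g (snd p) else \<zero>)" for w
    by (rule mult_eq[OF f g]) (use KM_D[OF f] KM_D[OF g] in auto)
  have closed: "(f \<otimes>\<^bsub>KM\<^esub> g) w \<in> carrier K" for w
    unfolding eq by (rule K.finsum_closed) (use fK gK in auto)
  have outside: "(f \<otimes>\<^bsub>KM\<^esub> g) w = \<zero>" if w: "w \<notin> ?T" for w
  proof -
    have "fst p \<otimes>\<^bsub>M\<^esub> snd p \<noteq> w" if "p \<in> supp f \<times> supp g" for p
      using w imageI[OF that, of "\<lambda>(u, v). u \<otimes>\<^bsub>M\<^esub> v"] by (metis case_prod_beta)
    then show ?thesis
      unfolding eq by (intro K.add.finprod_one_eqI if_not_P)
  qed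
  have sub: "supp (f \<otimes>\<^bsub>KM\<^esub> g) \<subseteq> ?T" using outside by blast
  show ?thesis
  proof (rule KM_I[OF closed])
    have "?T \<subseteq> carrier M" using KM_D(4)[OF f] KM_D(4)[OF g] by auto
    then show "supp (f \<otimes>\<^bsub>KM\<^esub> g) \<subseteq> carrier M" by (rule order_trans[OF sub])
    have "finite ?T" using KM_D(3)[OF f] KM_D(3)[OF g] by simp
    then show "finite (supp (f \<otimes>\<^bsub>KM\<^esub> g))" by (rule finite_subset[OF sub])
  qed
qed

lemma mult_l_distr:
  assumes f: "f \<in> carrier KM" and g: "g \<in> carrier KM" and h: "h \<in> carrier KM"
  shows "(f \<oplus>\<^bsub>KM\<^esub> g) \<otimes>\<^bsub>KM\<^esub> h = f \<otimes>\<^bsub>KM\<^esub> h \<oplus>\<^bsub>KM\<^esub> g \<otimes>\<^bsub>KM\<^esub> h"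
proof
  fix w
  note [simp] = KM_D(1)[OF f] KM_D(1)[OF g] KM_D(1)[OF h]
  let ?A = "supp f \<union> supp g" and ?B = "supp h"
  have fin: "finite ?A" "finite ?B" using KM_D(3) f g h by auto
  note eqs = mult_eq[OF add_closed[OF f g] h fin(1) supp_add fin(2) order_refl]
    mult_eq[OF f h fin(1) sup_ge1 fin(2) order_refl] mult_eq[OF g h fin(1) sup_ge2 fin(2) order_refl]
  have "((f \<oplus>\<^bsub>KM\<^esub> g) \<otimes>\<^bsub>KM\<^esub> h) w = (f \<otimes>\<^bsub>KM\<^esub> h) w \<oplus> (g \<otimes>\<^bsub>KM\<^esub> h) w"
    \<comment> \<open>The two sums over the common rectangle are merged;
      \<open>K.add.finprod_multf\<close> is removed from the simplifier since it would split the
      merged sum again.\<close>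
    unfolding eqs by (subst K.finsum_addf[symmetric])
      (auto intro!: K.finsum_cong' simp: KM_simps(4) K.l_distr
        simp del: K.add.finprod_multf)
  then show "((f \<oplus>\<^bsub>KM\<^esub> g) \<otimes>\<^bsub>KM\<^esub> h) w = (f \<otimes>\<^bsub>KM\<^esub> h \<oplus>\<^bsub>KM\<^esub> g \<otimes>\<^bsub>KM\<^esub> h) w"
    by (simp add: KM_simps(4))
qed

lemma mult_r_distr:
  assumes f: "f \<in> carrier KM" and g: "g \<in> carrier KM" and h: "h \<in> carrier KM"
  shows "h \<otimes>\<^bsub>KM\<^esub> (f \<oplus>\<^bsub>KM\<^esub> g) = h \<otimes>\<^bsub>KM\<^esub> f \<oplus>\<^bsub>KM\<^esub> h \<otimes>\<^bsub>KM\<^esub> g"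
proof
  fix w
  note [simp] = KM_D(1)[OF f] KM_D(1)[OF g] KM_D(1)[OF h]
  let ?A = "supp f \<union> supp g" and ?B = "supp h"
  have fin: "finite ?A" "finite ?B" using KM_D(3) f g h by auto
  note eqs = mult_eq[OF h add_closed[OF f g] fin(2) order_refl fin(1) supp_add]
    mult_eq[OF h f fin(2) order_refl fin(1) sup_ge1] mult_eq[OF h g fin(2) order_refl fin(1) sup_ge2]
  have "(h \<otimes>\<^bsub>KM\<^esub> (f \<oplus>\<^bsub>KM\<^esub> g)) w = (h \<otimes>\<^bsub>KM\<^esub> f) w \<oplus> (h \<otimes>\<^bsub>KM\<^esub> g) w"
    unfolding eqs by (subst K.finsum_addf[symmetric])
      (auto intro!: K.finsum_cong' simp: KM_simps(4) K.r_distr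
        simp del: K.add.finprod_multf)
  then show "(h \<otimes>\<^bsub>KM\<^esub> (f \<oplus>\<^bsub>KM\<^esub> g)) w = (h \<otimes>\<^bsub>KM\<^esub> f \<oplus>\<^bsub>KM\<^esub> h \<otimes>\<^bsub>KM\<^esub> g) w"
    by (simp add: KM_simps(4))
qed

lemma mult_smult:
  assumes a: "a \<in> carrier K" and f: "f \<in> carrier KM" and g: "g \<in> carrier KM"
  shows "(a \<odot>\<^bsub>KM\<^esub> f) \<otimes>\<^bsub>KM\<^esub> g = a \<odot>\<^bsub>KM\<^esub> (f \<otimes>\<^bsub>KM\<^esub> g)"
    and "f \<otimes>\<^bsub>KM\<^esub> (a \<odot>\<^bsub>KM\<^esub> g) = a \<odot>\<^bsub>KM\<^esub> (f \<otimes>\<^bsub>KM\<^esub> g)"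
proof -
  note [simp] = KM_D(1)[OF f] KM_D(1)[OF g] a
  note fin = KM_D(3)[OF f] KM_D(3)[OF g]
  have "((a \<odot>\<^bsub>KM\<^esub> f) \<otimes>\<^bsub>KM\<^esub> g) w = a \<otimes> (f \<otimes>\<^bsub>KM\<^esub> g) w" for w
    by (subst mult_eq[OF smult_closed[OF a f] g fin(1) supp_smult[OF a] fin(2) order_refl],
        subst mult_eq[OF f g fin(1) order_refl fin(2) order_refl], subst K.finsum_rdistr)
      (use fin in \<open>auto intro!: K.finsum_cong' simp: KM_simps(5) K.m_assoc\<close>)
  then show "(a \<odot>\<^bsub>KM\<^esub> f) \<otimes>\<^bsub>KM\<^esub> g = a \<odot>\<^bsub>KM\<^esub> (f \<otimes>\<^bsub>KM\<^esub> g)"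
    by (simp add: fun_eq_iff KM_simps(5))
  have "(f \<otimes>\<^bsub>KM\<^esub> (a \<odot>\<^bsub>KM\<^esub> g)) w = a \<otimes> (f \<otimes>\<^bsub>KM\<^esub> g) w" for w
    by (subst mult_eq[OF f smult_closed[OF a g] fin(1) order_refl fin(2) supp_smult[OF a]],
        subst mult_eq[OF f g fin(1) order_refl fin(2) order_refl], subst K.finsum_rdistr)
      (use fin in \<open>auto intro!: K.finsum_cong' simp: KM_simps(5) K.m_lcomm\<close>)
  then show "f \<otimes>\<^bsub>KM\<^esub> (a \<odot>\<^bsub>KM\<^esub> g) = a \<odot>\<^bsub>KM\<^esub> (f \<otimes>\<^bsub>KM\<^esub> g)"
    by (simp add: fun_eq_iff KM_simps(5))
qed

lemma monomial_mult:
  assumes "u \<in> carrier M" "v \<in> carrier M"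
  shows "monomial K u \<otimes>\<^bsub>KM\<^esub> monomial K v = monomial K (u \<otimes>\<^bsub>M\<^esub> v)"
proof
  fix w
  have "(monomial K u \<otimes>\<^bsub>KM\<^esub> monomial K v) w = (\<Oplus>p\<in>{u} \<times> {v}.
      if fst p \<otimes>\<^bsub>M\<^esub> snd p = w then monomial K u (fst p) \<otimes> monomial K v (snd p) else \<zero>)"
    by (rule mult_eq) (auto simp: monomial_closed assms supp_monomial)
  then show "(monomial K u \<otimes>\<^bsub>KM\<^esub> monomial K v) w = monomial K (u \<otimes>\<^bsub>M\<^esub> v) w"
    by (simp add: monomial_def)
qed

lemma mult_zero:
  assumes f: "f \<in> carrier KM"
  shows "\<zero>\<^bsub>KM\<^esub> \<otimes>\<^bsub>KM\<^esub> f = \<zero>\<^bsub>KM\<^esub>" "f \<otimes>\<^bsub>KM\<^esub> \<zero>\<^bsub>KM\<^esub> = \<zero>\<^bsub>KM\<^esub>"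
  using mult_eq[OF zero_closed f, of "{}" "supp f"] mult_eq[OF f zero_closed, of "supp f" "{}"]
    KM_D(3)[OF f] by (auto simp: KM_simps(3))

lemmas KM_closed = zero_closed add_closed smult_closed mult_closed monomial_closed
lemmas mult_linear = mult_l_distr mult_r_distr mult_smult mult_zero

lemma one_mult:
  assumes "f \<in> carrier KM"
  shows "\<one>\<^bsub>KM\<^esub> \<otimes>\<^bsub>KM\<^esub> f = f" "f \<otimes>\<^bsub>KM\<^esub> \<one>\<^bsub>KM\<^esub> = f"
  using assms
  by (induction rule: KM_induct) (simp_all add: mult_linear KM_closed KM_simps(2) monomial_mult)

lemma smult_linear:
  "\<lbrakk>a \<in> carrier K; f \<in> carrier KM; g \<in> carrier KM\<rbrakk> \<Longrightarrow>
    a \<odot>\<^bsub>KM\<^esub> (f \<oplus>\<^bsub>KM\<^esub> g) = a \<odot>\<^bsub>KM\<^esub> f \<oplus>\<^bsub>KM\<^esub> a \<odot>\<^bsub>KM\<^esub> g"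
  "a \<in> carrier K \<Longrightarrow> a \<odot>\<^bsub>KM\<^esub> \<zero>\<^bsub>KM\<^esub> = \<zero>\<^bsub>KM\<^esub>"
  by (auto simp: KM_simps K.r_distr)

text \<open>Both sides are trilinear, so associativity descends to that of \<open>M\<close> on
  monomials. The factors are freed one at a time: \<open>h\<close>, then \<open>g\<close>, then
  \<open>f\<close>.\<close>

lemma mult_assoc:
  assumes f: "f \<in> carrier KM" and g: "g \<in> carrier KM" and h: "h \<in> carrier KM"
  shows "(f \<otimes>\<^bsub>KM\<^esub> g) \<otimes>\<^bsub>KM\<^esub> h = f \<otimes>\<^bsub>KM\<^esub> (g \<otimes>\<^bsub>KM\<^esub> h)"
proof -
  note lin = mult_linear smult_linear KM_closed
  have 1: "(monomial K u \<otimes>\<^bsub>KM\<^esub> monomial K v) \<otimes>\<^bsub>KM\<^esub> h =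
      monomial K u \<otimes>\<^bsub>KM\<^esub> (monomial K v \<otimes>\<^bsub>KM\<^esub> h)"
    if "u \<in> carrier M" "v \<in> carrier M" for u v
    using h that by (induction rule: KM_induct) (simp_all add: lin monomial_mult M.m_assoc)
  have 2: "(monomial K u \<otimes>\<^bsub>KM\<^esub> g) \<otimes>\<^bsub>KM\<^esub> h = monomial K u \<otimes>\<^bsub>KM\<^esub> (g \<otimes>\<^bsub>KM\<^esub> h)"
    if "u \<in> carrier M" for u
    using g h that by (induction rule: KM_induct) (simp_all add: lin 1)
  show ?thesis
    using f g h by (induction rule: KM_induct) (simp_all add: lin 2)
qed

lemma assoc_algebra_KM: "assoc_algebra K KM"
proof (rule assoc_algebraI)
  show "\<exists>g\<in>carrier KM. g \<oplus>\<^bsub>KM\<^esub> f = \<zero>\<^bsub>KM\<^esub>" if f: "f \<in> carrier KM" for f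
  proof
    show "(\<ominus> \<one>) \<odot>\<^bsub>KM\<^esub> f \<in> carrier KM" using f by (simp add: smult_closed)
    show "(\<ominus> \<one>) \<odot>\<^bsub>KM\<^esub> f \<oplus>\<^bsub>KM\<^esub> f = \<zero>\<^bsub>KM\<^esub>"
      using KM_D(1)[OF f] by (simp add: KM_simps K.l_minus K.l_neg)
  qed
  show "\<one>\<^bsub>KM\<^esub> \<in> carrier KM" by (simp add: KM_simps(2) monomial_closed)
qed (use KM_closed mult_linear one_mult mult_assoc K.cring_axioms in
    \<open>auto simp: KM_simps(3-5) KM_D(1) K.add.m_ac K.l_distr K.r_distr K.m_assoc\<close>)

lemma cring_KM:
  assumes comm: "\<And>u v. \<lbrakk>u \<in> carrier M; v \<in> carrier M\<rbrakk> \<Longrightarrow> u \<otimes>\<^bsub>M\<^esub> v = v \<otimes>\<^bsub>M\<^esub> u"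
  shows "cring KM"
proof -
  interpret KM: assoc_algebra K KM by (rule assoc_algebra_KM)
  have 1: "monomial K u \<otimes>\<^bsub>KM\<^esub> g = g \<otimes>\<^bsub>KM\<^esub> monomial K u"
    if "g \<in> carrier KM" "u \<in> carrier M" for g u
    using that
    by (induction rule: KM_induct) (simp_all add: mult_linear KM_closed monomial_mult comm)
  have "f \<otimes>\<^bsub>KM\<^esub> g = g \<otimes>\<^bsub>KM\<^esub> f" if "f \<in> carrier KM" "g \<in> carrier KM" for f g
    using that by (induction rule: KM_induct) (simp_all add: mult_linear KM_closed 1)
  then show ?thesis
    by (intro cring.intro comm_monoid.intro comm_monoid_axioms.intro KM.ring_axioms
        KM.monoid_axioms)
qed

lemma KM_span:
  assumes "\<And>w. w \<in> carrier M \<Longrightarrow> monomial K w \<in> alg_span K KM G" and "G \<subseteq> carrier KM"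
  shows "carrier KM = alg_span K KM G"
proof
  interpret KM: assoc_algebra K KM by (rule assoc_algebra_KM)
  show "carrier KM \<subseteq> alg_span K KM G"
  proof
    fix f assume "f \<in> carrier KM"
    then show "f \<in> alg_span K KM G"
    proof (induction rule: KM_induct)
      case zero
      show ?case
        using alg_span.smult[OF K.zero_closed alg_span.one, of KM G] by simp
    qed (use assms in \<open>auto intro!: alg_span.add alg_span.smult\<close>)
  qed
  have "f \<in> carrier KM" if "f \<in> alg_span K KM G" for f
    using that by induction (use assms in auto)
  then show "alg_span K KM G \<subseteq> carrier KM" by blast
qed

text \<open>Both sides of multiplicativity are bilinear, so monomials suffice; the second factor is
  generalized first, then the first factor.\<close>

lemma alg_hom_of_linear:
  assumes R: "assoc_algebra K R"
    and closed: "\<And>f. f \<in> carrier KM \<Longrightarrow> F f \<in> carrier R"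
    and add: "\<And>f g. \<lbrakk>f \<in> carrier KM; g \<in> carrier KM\<rbrakk> \<Longrightarrow> F (f \<oplus>\<^bsub>KM\<^esub> g) = F f \<oplus>\<^bsub>R\<^esub> F g"
    and smult: "\<And>a f. \<lbrakk>a \<in> carrier K; f \<in> carrier KM\<rbrakk> \<Longrightarrow> F (a \<odot>\<^bsub>KM\<^esub> f) = a \<odot>\<^bsub>R\<^esub> F f"
    and one: "F (monomial K \<one>\<^bsub>M\<^esub>) = \<one>\<^bsub>R\<^esub>"
    and mult: "\<And>u v. \<lbrakk>u \<in> carrier M; v \<in> carrier M\<rbrakk> \<Longrightarrow>
      F (monomial K (u \<otimes>\<^bsub>M\<^esub> v)) = F (monomial K u) \<otimes>\<^bsub>R\<^esub> F (monomial K v)"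
  shows "F \<in> alg_hom K KM R"
proof (rule alg_homI)
  interpret KM: assoc_algebra K KM by (rule assoc_algebra_KM)
  interpret R: assoc_algebra K R by (rule R)
  have zero: "F \<zero>\<^bsub>KM\<^esub> = \<zero>\<^bsub>R\<^esub>"
    using smult[of \<zero> "\<zero>\<^bsub>KM\<^esub>"] closed by simp
  note lin = mult_linear KM_closed add smult closed zero R.l_distr R.r_distr
    R.smult_mult_left R.smult_mult_right
  have 1: "F (monomial K u \<otimes>\<^bsub>KM\<^esub> g) = F (monomial K u) \<otimes>\<^bsub>R\<^esub> F g"
    if "g \<in> carrier KM" "u \<in> carrier M" for g u
    using that by (induction rule: KM_induct) (simp_all add: lin monomial_mult mult)
  show "F (f \<otimes>\<^bsub>KM\<^esub> g) = F f \<otimes>\<^bsub>R\<^esub> F g" if "f \<in> carrier KM" "g \<in> carrier KM" for f g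
    using that by (induction rule: KM_induct) (simp_all add: lin 1)
  show "F \<one>\<^bsub>KM\<^esub> = \<one>\<^bsub>R\<^esub>" by (simp add: KM_simps(2) one)
qed (simp_all add: closed add smult)

section \<open>Universal property and functoriality of monoid algebras\<close>

definition lift :: "('k, 'r, 'q) module_scheme \<Rightarrow> ('w \<Rightarrow> 'r) \<Rightarrow> ('w \<Rightarrow> 'k) \<Rightarrow> 'r"
  where "lift R h f = (\<Oplus>\<^bsub>R\<^esub>w\<in>supp f. f w \<odot>\<^bsub>R\<^esub> h w)"

text \<open>Enlarging the index set adds only zero terms; additivity of \<open>lift\<close> needs
  one set containing the supports of both summands.\<close>

lemma lift_eq:
  assumes R: "assoc_algebra K R" and h: "h \<in> carrier M \<rightarrow> carrier R" and f: "f \<in> carrier KM"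
    and A: "finite A" "supp f \<subseteq> A" "A \<subseteq> carrier M"
  shows "lift R h f = (\<Oplus>\<^bsub>R\<^esub>w\<in>A. f w \<odot>\<^bsub>R\<^esub> h w)"
proof -
  interpret R: assoc_algebra K R by (rule R)
  show ?thesis
    unfolding lift_def
    by (rule R.add.finprod_mono_neutral_cong_left)
      (use A h KM_D(1)[OF f] in \<open>auto simp: Pi_iff subset_iff\<close>)
qed

text \<open>A homomorphism from \<open>M\<close> to the multiplicative monoid of \<open>R\<close>
  extends linearly; on monomials its multiplicativity is that of \<open>h\<close>.\<close>

lemma lift_alg_hom:
  assumes R: "assoc_algebra K R" and h: "h \<in> hom M R" "h \<one>\<^bsub>M\<^esub> = \<one>\<^bsub>R\<^esub>"
  shows "lift R h \<in> alg_hom K KM R" and "w \<in> carrier M \<Longrightarrow> lift R h (monomial K w) = h w"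
proof -
  interpret R: assoc_algebra K R by (rule R)
  have hR: "h \<in> carrier M \<rightarrow> carrier R"
    and h_mult: "\<And>u v. \<lbrakk>u \<in> carrier M; v \<in> carrier M\<rbrakk> \<Longrightarrow> h (u \<otimes>\<^bsub>M\<^esub> v) = h u \<otimes>\<^bsub>R\<^esub> h v"
    using h by (auto simp: hom_def)
  note eq = lift_eq[OF R hR]
  have mono: "lift R h (monomial K w) = h w" if "w \<in> carrier M" for w
    using eq[OF monomial_closed[OF that] _ supp_monomial] that hR
    by (auto simp: monomial_def R.finsum_insert Pi_iff)
  then show "w \<in> carrier M \<Longrightarrow> lift R h (monomial K w) = h w" .
  show "lift R h \<in> alg_hom K KM R"
  proof (rule alg_hom_of_linear[OF R])
    fix f assume f: "f \<in> carrier KM"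
    note [simp] = KM_D(1)[OF f]
    have sub: "supp f \<subseteq> carrier M" using KM_D(4)[OF f] .
    show "lift R h f \<in> carrier R"
      unfolding lift_def by (rule R.finsum_closed) (use sub hR in \<open>auto simp: Pi_iff subset_iff\<close>)
    show "lift R h (a \<odot>\<^bsub>KM\<^esub> f) = a \<odot>\<^bsub>R\<^esub> lift R h f" if a: "a \<in> carrier K" for a
      by (subst eq[OF smult_closed[OF a f] KM_D(3)[OF f] supp_smult[OF a] sub],
          unfold lift_def, subst R.finsum_smult_ldistr)
        (use sub hR a KM_D(3)[OF f] in
          \<open>auto intro!: R.finsum_cong' simp: KM_simps(5) R.smult_assoc1 Pi_iff subset_iff\<close>)
    fix g assume g: "g \<in> carrier KM"
    note [simp] = KM_D(1)[OF g]
    let ?A = "supp f \<union> supp g"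
    have A: "finite ?A" "?A \<subseteq> carrier M" using KM_D(3,4)[OF f] KM_D(3,4)[OF g] by auto
    show "lift R h (f \<oplus>\<^bsub>KM\<^esub> g) = lift R h f \<oplus>\<^bsub>R\<^esub> lift R h g"
      by (subst eq[OF add_closed[OF f g] A(1) supp_add A(2)], subst eq[OF f A(1) _ A(2)], simp,
          subst eq[OF g A(1) _ A(2)], simp, subst R.finsum_addf[symmetric])
        (use A hR in
          \<open>auto intro!: R.finsum_cong' simp: KM_simps(4) R.smult_l_distr Pi_iff subset_iff
            simp del: R.add.finprod_multf\<close>)
  qed (use h h_mult mono in auto)
qed

lemma monoid_algebra_map_eq:
  assumes f: "f \<in> carrier KM" and A: "finite A" "supp f \<subseteq> A"
  shows "monoid_algebra_map K h f w = (\<Oplus>u\<in>A. if h u = w then f u else \<zero>)"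
  unfolding monoid_algebra_map_def
  by (rule K.add.finprod_mono_neutral_cong_left) (use A KM_D(1)[OF f] in auto)

end

text \<open>Coefficients are summed over the fibres of \<open>h\<close>. Writing the fibre condition
  inside the summand makes linearity termwise, and monomials inherit multiplicativity from
  \<open>h\<close>.\<close>

lemma monoid_algebra_map_alg_hom:
  assumes "monoid_algebra_over K M" "monoid_algebra_over K N"
    and h: "h \<in> hom M N" "h \<one>\<^bsub>M\<^esub> = \<one>\<^bsub>N\<^esub>"
  shows "monoid_algebra_map K h \<in> alg_hom K (monoid_algebra K M) (monoid_algebra K N)"
    and "u \<in> carrier M \<Longrightarrow> monoid_algebra_map K h (monomial K u) = monomial K (h u)"
proof -
  interpret M: monoid_algebra_over K M by fact
  interpret N: monoid_algebra_over K N by fact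
  have hN: "h \<in> carrier M \<rightarrow> carrier N"
    and h_mult: "\<And>u v. \<lbrakk>u \<in> carrier M; v \<in> carrier M\<rbrakk> \<Longrightarrow> h (u \<otimes>\<^bsub>M\<^esub> v) = h u \<otimes>\<^bsub>N\<^esub> h v"
    using h by (auto simp: hom_def)
  note eq = M.monoid_algebra_map_eq
  have mono: "monoid_algebra_map K h (monomial K u) = monomial K (h u)" if "u \<in> carrier M" for u
  proof
    fix w
    have "monoid_algebra_map K h (monomial K u) w =
        (\<Oplus>\<^bsub>K\<^esub>x\<in>{u}. if h x = w then monomial K u x else \<zero>\<^bsub>K\<^esub>)"
      by (rule eq[OF M.monomial_closed[OF that] _ M.supp_monomial]) simp
    also have "\<dots> = monomial K (h u) w"
      by (simp add: monomial_def eq_commute)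
    finally show "monoid_algebra_map K h (monomial K u) w = monomial K (h u) w" .
  qed
  then show "u \<in> carrier M \<Longrightarrow> monoid_algebra_map K h (monomial K u) = monomial K (h u)" .
  show "monoid_algebra_map K h \<in> alg_hom K M.KM N.KM"
  proof (rule M.alg_hom_of_linear[OF N.assoc_algebra_KM])
    fix f assume f: "f \<in> carrier M.KM"
    note [simp] = M.KM_D(1)[OF f]
    note fin = M.KM_D(3)[OF f]
    have closed: "monoid_algebra_map K h f w \<in> carrier K" for w
      unfolding monoid_algebra_map_def by (rule M.K.finsum_closed) auto
    have outside: "monoid_algebra_map K h f w = \<zero>\<^bsub>K\<^esub>" if "w \<notin> h ` M.supp f" for w
      unfolding monoid_algebra_map_def by (rule M.K.add.finprod_one_eqI) (use that in auto)
    have sub: "N.supp (monoid_algebra_map K h f) \<subseteq> h ` M.supp f" using outside by blast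
    show "monoid_algebra_map K h f \<in> carrier N.KM"
    proof (rule N.KM_I[OF closed])
      have "h ` M.supp f \<subseteq> carrier N" using M.KM_D(4)[OF f] hN by auto
      then show "N.supp (monoid_algebra_map K h f) \<subseteq> carrier N" by (rule order_trans[OF sub])
      show "finite (N.supp (monoid_algebra_map K h f))"
        using sub fin by (rule finite_surj[rotated])
    qed
    show "monoid_algebra_map K h (a \<odot>\<^bsub>M.KM\<^esub> f) = a \<odot>\<^bsub>N.KM\<^esub> monoid_algebra_map K h f"
      if a: "a \<in> carrier K" for a
      unfolding N.KM_simps(5)
      by (rule ext, subst eq[OF M.smult_closed[OF a f] fin M.supp_smult[OF a]],
          subst eq[OF f fin order_refl], subst M.K.finsum_rdistr)
        (use fin a in \<open>auto intro!: M.K.finsum_cong' simp: M.KM_simps(5)\<close>)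
    fix g assume g: "g \<in> carrier M.KM"
    note [simp] = M.KM_D(1)[OF g]
    let ?A = "M.supp f \<union> M.supp g"
    have A: "finite ?A" using fin M.KM_D(3)[OF g] by auto
    show "monoid_algebra_map K h (f \<oplus>\<^bsub>M.KM\<^esub> g) =
        monoid_algebra_map K h f \<oplus>\<^bsub>N.KM\<^esub> monoid_algebra_map K h g"
      unfolding N.KM_simps(4)
      by (rule ext, subst eq[OF M.add_closed[OF f g] A M.supp_add], subst eq[OF f A], simp,
          subst eq[OF g A], simp, subst M.K.finsum_addf[symmetric])
        (auto intro!: M.K.finsum_cong' simp: M.KM_simps(4) simp del: M.K.add.finprod_multf)
  qed (use h h_mult mono hN in \<open>auto simp: N.monomial_mult N.KM_simps(2) Pi_iff\<close>)
qed


section \<open>Free monoids\<close>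

lemma monoid_free_monoid: "Group.monoid (free_monoid X)"
  by (rule Group.monoidI) (auto simp: free_monoid_def)

lemma monoid_free_comm_monoid: "Group.monoid (free_comm_monoid X)"
  by (rule Group.monoidI) (auto simp: free_comm_monoid_def)

lemma (in Group.monoid) free_monoid_extend:
  assumes g: "g \<in> X \<rightarrow> carrier G"
  obtains h where "h \<in> hom (free_monoid X) G" "h [] = \<one>" "\<And>x. x \<in> X \<Longrightarrow> h [x] = g x"
proof
  define h where "h xs = foldr (\<lambda>x r. g x \<otimes> r) xs \<one>" for xs
  have closed: "h xs \<in> carrier G" if "xs \<in> lists X" for xs
    using that g by induction (auto simp: h_def)
  have "h (xs @ ys) = h xs \<otimes> h ys" if "xs \<in> lists X" "ys \<in> lists X" for xs ys
    using that
  proof induction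
    case Nil
    then show ?case using closed by (simp add: h_def)
  next
    case (Cons x xs)
    moreover have "h (x # zs) = g x \<otimes> h zs" for zs by (simp add: h_def)
    moreover have "g x \<in> carrier G" using Cons.hyps g by blast
    ultimately show ?case using closed by (simp add: m_assoc)
  qed
  then show "h \<in> hom (free_monoid X) G"
    using closed by (auto simp: hom_def free_monoid_def)
  show "h [] = \<one>" by (simp add: h_def)
  show "h [x] = g x" if "x \<in> X" for x using that g by (auto simp: h_def Pi_iff)
qed

text \<open>Multiplicities serve as exponents, which makes the value independent of an ordering of
  the multiset.\<close>

lemma (in comm_monoid) free_comm_monoid_extend:
  assumes g: "g \<in> X \<rightarrow> carrier G"
  obtains h where "h \<in> hom (free_comm_monoid X) G" "h {#} = \<one>" "\<And>x. x \<in> X \<Longrightarrow> h {#x#} = g x"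
proof
  define h where "h m = (\<Otimes>x\<in>set_mset m. g x [^] count m x)" for m
  have gx: "g x \<in> carrier G" if "x \<in> X" for x using g that by auto
  \<comment> \<open>Elements outside the multiset have exponent 0 and contribute the unit, so two
    multisets can share the index set formed by the union of their supports.\<close>
  have h_eq: "h m = (\<Otimes>x\<in>S. g x [^] count m x)"
    if "finite S" "set_mset m \<subseteq> S" "S \<subseteq> X" for m S
    unfolding h_def
    by (rule finprod_mono_neutral_cong_left)
      (use that gx in \<open>auto simp: subset_iff not_in_iff\<close>)
  have "h (m + n) = h m \<otimes> h n" if "set_mset m \<subseteq> X" "set_mset n \<subseteq> X" for m n
  proof -
    let ?S = "set_mset m \<union> set_mset n"
    have "h (m + n) = (\<Otimes>x\<in>?S. g x [^] count m x \<otimes> g x [^] count n x)"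
      unfolding h_def
      by (rule finprod_cong') (use that gx in \<open>auto simp: nat_pow_mult subset_iff\<close>)
    also have "\<dots> = h m \<otimes> h n"
      using that gx by (subst (1 2) h_eq[of ?S]) (auto intro!: finprod_multf simp: subset_iff)
    finally show ?thesis .
  qed
  moreover have "h m \<in> carrier G" if "set_mset m \<subseteq> X" for m
    unfolding h_def using that gx by (intro finprod_closed) auto
  ultimately show "h \<in> hom (free_comm_monoid X) G"
    by (auto simp: hom_def free_comm_monoid_def)
  show "h {#} = \<one>" by (simp add: h_def)
  show "h {#x#} = g x" if "x \<in> X" for x
    using gx[OF that] by (simp add: h_def)
qed


section \<open>Polynomial algebras\<close>

context cring
begin

lemma monoid_algebra_over_free:
  "monoid_algebra_over R (free_monoid X)" "monoid_algebra_over R (free_comm_monoid X)"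
  by (simp_all add: monoid_algebra_over_def monoid_free_monoid monoid_free_comm_monoid cring_axioms)

lemma assoc_algebra_poly: "assoc_algebra R (nc_poly R X)" "assoc_algebra R (comm_poly R X)"
  unfolding nc_poly_def comm_poly_def
  by (intro monoid_algebra_over.assoc_algebra_KM monoid_algebra_over_free)+

lemma cring_comm_poly: "cring (comm_poly R X)"
  unfolding comm_poly_def
  by (rule monoid_algebra_over.cring_KM[OF monoid_algebra_over_free(2)])
    (simp add: free_comm_monoid_def add.commute)

lemma nc_poly_span: "carrier (nc_poly R X) = alg_span R (nc_poly R X) ((\<lambda>x. monomial R [x]) ` X)"
  (is "_ = alg_span R ?P ?G")
proof -
  interpret P: monoid_algebra_over R "free_monoid X" by (rule monoid_algebra_over_free)
  have "monomial R w \<in> alg_span R ?P ?G" if "w \<in> lists X" for w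
    using that
  proof induction
    case Nil
    then show ?case
      \<comment> \<open>The unit is first turned into the monomial at the monoid unit while
        \<open>free_monoid X\<close> is still folded; only then does that monoid unit become the
        empty word.\<close>
      using alg_span.one[of ?P R ?G] by (simp add: nc_poly_def P.KM_simps(2)) (simp add: free_monoid_def)
  next
    case (Cons x xs)
    then have "monomial R (x # xs) = monomial R [x] \<otimes>\<^bsub>?P\<^esub> monomial R xs"
      using P.monomial_mult[of "[x]" xs] by (simp add: nc_poly_def free_monoid_def in_listsI)
    then show ?case
      using Cons by (auto intro!: alg_span.mult intro: alg_span.gen)
  qed
  then show ?thesis
    unfolding nc_poly_def
    by (intro P.KM_span image_subsetI P.monomial_closed) (auto simp: free_monoid_def)
qed

lemma comm_poly_span:
  "carrier (comm_poly R X) = alg_span R (comm_poly R X) ((\<lambda>x. monomial R {#x#}) ` X)"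
  (is "_ = alg_span R ?P ?G")
proof -
  interpret P: monoid_algebra_over R "free_comm_monoid X" by (rule monoid_algebra_over_free)
  have "monomial R w \<in> alg_span R ?P ?G" if "set_mset w \<subseteq> X" for w
    using that
  proof (induction w)
    case empty
    then show ?case
      using alg_span.one[of ?P R ?G]
      by (simp add: comm_poly_def P.KM_simps(2)) (simp add: free_comm_monoid_def)
  next
    case (add x w)
    then have "monomial R (add_mset x w) = monomial R {#x#} \<otimes>\<^bsub>?P\<^esub> monomial R w"
      using P.monomial_mult[of "{#x#}" w] by (simp add: comm_poly_def free_comm_monoid_def)
    then show ?case
      using add by (auto intro!: alg_span.mult intro: alg_span.gen)
  qed
  then show ?thesis
    unfolding comm_poly_def
    by (intro P.KM_span image_subsetI P.monomial_closed) (auto simp: free_comm_monoid_def)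
qed

lemma nc_poly_extend:
  assumes S: "assoc_algebra R S" and g: "g \<in> X \<rightarrow> carrier S"
  shows "\<exists>\<Psi>\<in>alg_hom R (nc_poly R X) S. \<forall>x\<in>X. \<Psi> (monomial R [x]) = g x"
proof -
  interpret P: monoid_algebra_over R "free_monoid X" by (rule monoid_algebra_over_free)
  interpret S: assoc_algebra R S by (rule S)
  obtain h where h: "h \<in> hom (free_monoid X) S" "h [] = \<one>\<^bsub>S\<^esub>" "\<And>x. x \<in> X \<Longrightarrow> h [x] = g x"
    using S.free_monoid_extend[OF g] by metis
  then have "h \<one>\<^bsub>free_monoid X\<^esub> = \<one>\<^bsub>S\<^esub>" by (simp add: free_monoid_def)
  note lift = P.lift_alg_hom[OF S h(1) this]
  show ?thesis
    by (rule bexI[of _ "P.lift S h"]) (use lift h(3) in \<open>auto simp: nc_poly_def free_monoid_def\<close>)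
qed

lemma comm_poly_extend:
  assumes S: "assoc_algebra R S" "cring S" and g: "g \<in> X \<rightarrow> carrier S"
  shows "\<exists>\<Psi>\<in>alg_hom R (comm_poly R X) S. \<forall>x\<in>X. \<Psi> (monomial R {#x#}) = g x"
proof -
  interpret P: monoid_algebra_over R "free_comm_monoid X" by (rule monoid_algebra_over_free)
  interpret S: cring S by (rule S)
  obtain h where h: "h \<in> hom (free_comm_monoid X) S" "h {#} = \<one>\<^bsub>S\<^esub>"
    "\<And>x. x \<in> X \<Longrightarrow> h {#x#} = g x"
    using S.free_comm_monoid_extend[OF g] by metis
  then have "h \<one>\<^bsub>free_comm_monoid X\<^esub> = \<one>\<^bsub>S\<^esub>" by (simp add: free_comm_monoid_def)
  note lift = P.lift_alg_hom[OF S(1) h(1) this]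
  show ?thesis
    by (rule bexI[of _ "P.lift S h"])
      (use lift h(3) in \<open>auto simp: comm_poly_def free_comm_monoid_def\<close>)
qed

lemma nc_embed_alg_hom:
  "nc_embed R \<in> alg_hom R (nc_poly R X) (nc_poly R (Delta X))"
  "x \<in> X \<Longrightarrow> nc_embed R (monomial R [x]) = monomial R [(x, 0)]"
proof -
  have "map (\<lambda>x. (x, 0)) \<in> hom (free_monoid X) (free_monoid (Delta X))"
    by (auto simp: hom_def free_monoid_def Delta_def)
  note embed = monoid_algebra_map_alg_hom[OF monoid_algebra_over_free(1,1) this]
  show "nc_embed R \<in> alg_hom R (nc_poly R X) (nc_poly R (Delta X))"
    unfolding nc_embed_def nc_poly_def by (rule embed) (simp add: free_monoid_def)
  show "nc_embed R (monomial R [x]) = monomial R [(x, 0)]" if "x \<in> X"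
    unfolding nc_embed_def using embed(2)[of "[x]"] that by (simp add: free_monoid_def)
qed

lemma comm_embed_alg_hom:
  "comm_embed R \<in> alg_hom R (comm_poly R X) (comm_poly R (Delta X))"
  "x \<in> X \<Longrightarrow> comm_embed R (monomial R {#x#}) = monomial R {#(x, 0)#}"
proof -
  have "image_mset (\<lambda>x. (x, 0)) \<in> hom (free_comm_monoid X) (free_comm_monoid (Delta X))"
    by (auto simp: hom_def free_comm_monoid_def Delta_def)
  note embed = monoid_algebra_map_alg_hom[OF monoid_algebra_over_free(2,2) this]
  show "comm_embed R \<in> alg_hom R (comm_poly R X) (comm_poly R (Delta X))"
    unfolding comm_embed_def comm_poly_def by (rule embed) (simp add: free_comm_monoid_def)
  show "comm_embed R (monomial R {#x#}) = monomial R {#(x, 0)#}" if "x \<in> X"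
    unfolding comm_embed_def using embed(2)[of "{#x#}"] that by (simp add: free_comm_monoid_def)
qed

text \<open>As \<open>nc_diff_op\<close> is a definite description, its properties become available
  only through unique existence, obtained by freeness from the dual-algebra homomorphism.\<close>

lemma nc_diff_op:
  assumes l: "l \<in> carrier R"
  shows "differential_algebra R l (nc_poly R (Delta X)) (nc_diff_op R l X)"
    and "x \<in> X \<Longrightarrow> nc_diff_op R l X (monomial R [(x, n)]) = monomial R [(x, Suc n)]"
proof -
  interpret Q: assoc_algebra R "nc_poly R (Delta X)" by (rule assoc_algebra_poly)
  let ?gen = "\<lambda>y. monomial R [y]" and ?s = "\<lambda>(x, n). (x, Suc n)"
  have gen: "?gen y \<in> carrier (nc_poly R (Delta X))" if "y \<in> Delta X" for y
    unfolding nc_poly_span using that by (auto intro: alg_span.gen)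
  have s: "?s y \<in> Delta X" if "y \<in> Delta X" for y
    using that by (auto simp: Delta_def)
  have "\<exists>\<Phi>\<in>alg_hom R (nc_poly R (Delta X)) (weight_dual l (nc_poly R (Delta X))).
      \<forall>y\<in>Delta X. \<Phi> (?gen y) = (?gen y, ?gen (?s y))"
    by (rule nc_poly_extend[OF Q.assoc_algebra_weight_dual[OF l]])
      (use gen s in \<open>auto simp: weight_dual_simps\<close>)
  from Q.diff_op_ex1[OF l nc_poly_span s this]
  have "\<exists>!d. d \<in> extensional (carrier (nc_poly R (Delta X))) \<and>
      differential_algebra R l (nc_poly R (Delta X)) d \<and>
      (\<forall>x\<in>X. \<forall>n. d (monomial R [(x, n)]) = monomial R [(x, Suc n)])"
    by (simp add: Delta_def)
  from theI'[OF this]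
  show "differential_algebra R l (nc_poly R (Delta X)) (nc_diff_op R l X)"
    and "x \<in> X \<Longrightarrow> nc_diff_op R l X (monomial R [(x, n)]) = monomial R [(x, Suc n)]"
    by (simp_all add: nc_diff_op_def)
qed

text \<open>As in the noncommutative case, except that the extension from generators requires the
  dual algebra to be commutative.\<close>

lemma comm_diff_op:
  assumes l: "l \<in> carrier R"
  shows "differential_algebra R l (comm_poly R (Delta X)) (comm_diff_op R l X)"
    and "x \<in> X \<Longrightarrow> comm_diff_op R l X (monomial R {#(x, n)#}) = monomial R {#(x, Suc n)#}"
proof -
  interpret Q: assoc_algebra R "comm_poly R (Delta X)" by (rule assoc_algebra_poly)
  let ?gen = "\<lambda>y. monomial R {#y#}" and ?s = "\<lambda>(x, n). (x, Suc n)"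
  have gen: "?gen y \<in> carrier (comm_poly R (Delta X))" if "y \<in> Delta X" for y
    unfolding comm_poly_span using that by (auto intro: alg_span.gen)
  have s: "?s y \<in> Delta X" if "y \<in> Delta X" for y
    using that by (auto simp: Delta_def)
  have "\<exists>\<Phi>\<in>alg_hom R (comm_poly R (Delta X)) (weight_dual l (comm_poly R (Delta X))).
      \<forall>y\<in>Delta X. \<Phi> (?gen y) = (?gen y, ?gen (?s y))"
    by (rule comm_poly_extend[OF Q.assoc_algebra_weight_dual[OF l]
          Q.cring_weight_dual[OF l cring_comm_poly]])
      (use gen s in \<open>auto simp: weight_dual_simps\<close>)
  from Q.diff_op_ex1[OF l comm_poly_span s this]
  have "\<exists>!d. d \<in> extensional (carrier (comm_poly R (Delta X))) \<and>
      differential_algebra R l (comm_poly R (Delta X)) d \<and>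
      (\<forall>x\<in>X. \<forall>n. d (monomial R {#(x, n)#}) = monomial R {#(x, Suc n)#})"
    by (simp add: Delta_def)
  from theI'[OF this]
  show "differential_algebra R l (comm_poly R (Delta X)) (comm_diff_op R l X)"
    and "x \<in> X \<Longrightarrow> comm_diff_op R l X (monomial R {#(x, n)#}) = monomial R {#(x, Suc n)#}"
    by (simp_all add: comm_diff_op_def)
qed

text \<open>Noncommutative polynomials extend to every target algebra, so
  \<open>nc_poly_extend\<close> discharges the premise \<open>ext\<close> of
  \<open>universal_property\<close>.\<close>

lemma free_differential_algebra_nc_poly:
  assumes l: "l \<in> carrier R" and I: "ideal I (nc_poly R X)"
    and \<theta>: "\<theta> \<in> alg_iso R (alg_quot (nc_poly R X) I) A"
  shows "free_differential_algebra TYPE('r) R l A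
    (alg_quot (nc_poly R (Delta X)) (nc_diff_ideal R l X I))
    (diff_quot (nc_poly R (Delta X)) (nc_diff_op R l X) (nc_diff_ideal R l X I))
    (induced_map (nc_poly R X) I \<theta>
       (nc_poly R (Delta X)) (nc_diff_ideal R l X I) (nc_embed R))"
proof -
  interpret diff_presentation R l "nc_poly R X" "nc_poly R (Delta X)" "nc_diff_op R l X" X
    "\<lambda>x. monomial R [x]" "\<lambda>y. monomial R [y]" "nc_embed R" I A \<theta>
    by (intro diff_presentation.intro diff_presentation_axioms.intro assoc_algebra_poly
        nc_diff_op l nc_poly_span nc_embed_alg_hom I \<theta>)
  have J: "nc_diff_ideal R l X I = J" by (simp add: nc_diff_ideal_def J_def)
  show ?thesis
    unfolding J free_differential_algebra_def i_def[symmetric]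
    by (intro conjI allI impI Q.differential_algebra_diff_quot diff_ideal_J i_hom
        universal_property nc_poly_extend)
      (auto simp: differential_algebra_def)
qed

text \<open>Here \<open>ext\<close> holds because the definition tests only commutative targets.
  Commutativity of the quotient itself is the additional obligation.\<close>

lemma free_comm_differential_algebra_comm_poly:
  assumes l: "l \<in> carrier R" and I: "ideal I (comm_poly R X)"
    and \<theta>: "\<theta> \<in> alg_iso R (alg_quot (comm_poly R X) I) A"
  shows "free_comm_differential_algebra TYPE('r) R l A
    (alg_quot (comm_poly R (Delta X)) (comm_diff_ideal R l X I))
    (diff_quot (comm_poly R (Delta X)) (comm_diff_op R l X) (comm_diff_ideal R l X I))
    (induced_map (comm_poly R X) I \<theta>
       (comm_poly R (Delta X)) (comm_diff_ideal R l X I) (comm_embed R))"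
proof -
  interpret diff_presentation R l "comm_poly R X" "comm_poly R (Delta X)" "comm_diff_op R l X" X
    "\<lambda>x. monomial R {#x#}" "\<lambda>y. monomial R {#y#}" "comm_embed R" I A \<theta>
    by (intro diff_presentation.intro diff_presentation_axioms.intro assoc_algebra_poly
        comm_diff_op l comm_poly_span comm_embed_alg_hom I \<theta>)
  have J: "comm_diff_ideal R l X I = J" by (simp add: comm_diff_ideal_def J_def)
  \<comment> \<open>The coset map is surjective from a commutative ring, so commutativity passes to
    its image.\<close>
  have "cring (alg_quot (comm_poly R (Delta X)) J)"
    by (rule cring_image[OF cring_comm_poly coset_hom _ Q.assoc_algebra_alg_quot])
      (auto simp: alg_quot_simps J.ideal_axioms)
  then show ?thesis
    unfolding J free_comm_differential_algebra_def i_def[symmetric]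
    by (intro conjI allI impI Q.differential_algebra_diff_quot diff_ideal_J i_hom
        universal_property comm_poly_extend)
      (auto simp: differential_algebra_def)
qed

end

theorem proposition2p7:
  fixes K :: "('k, 'm) ring_scheme" and l :: 'k
  assumes "field_char_zero K" and "l \<in> carrier K"
  shows
    "(\<forall>(X :: 'x set) I (A :: ('k, 'a) module) \<theta>.
        assoc_algebra K A \<and> ideal I (nc_poly K X) \<and>
        \<theta> \<in> alg_iso K (alg_quot (nc_poly K X) I) A \<longrightarrow>
        free_differential_algebra TYPE('r) K l A
          (alg_quot (nc_poly K (Delta X)) (nc_diff_ideal K l X I))
          (diff_quot (nc_poly K (Delta X)) (nc_diff_op K l X) (nc_diff_ideal K l X I))
          (induced_map (nc_poly K X) I \<theta>
             (nc_poly K (Delta X)) (nc_diff_ideal K l X I) (nc_embed K))) \<and>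
     (\<forall>(X :: 'y set) I (A :: ('k, 'b) module) \<theta>.
        algebra K A \<and> ideal I (comm_poly K X) \<and>
        \<theta> \<in> alg_iso K (alg_quot (comm_poly K X) I) A \<longrightarrow>
        free_comm_differential_algebra TYPE('s) K l A
          (alg_quot (comm_poly K (Delta X)) (comm_diff_ideal K l X I))
          (diff_quot (comm_poly K (Delta X)) (comm_diff_op K l X) (comm_diff_ideal K l X I))
          (induced_map (comm_poly K X) I \<theta>
             (comm_poly K (Delta X)) (comm_diff_ideal K l X I) (comm_embed K)))"
proof -
  interpret field K
    using assms(1) by (simp add: field_char_zero_def)
  show ?thesis
    using assms(2) free_differential_algebra_nc_poly free_comm_differential_algebra_comm_poly
    by blast
qed

end
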